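(* For all $a\in\mathbb{R}$, \[ \frac{1}{4B_a^+}\leq\lambda^+_a\leq \frac{1}{B_a^+}\quad\mbox{and}\quad \frac{1}{4B_a^-}\leq\lambda^-_a\leq \frac{1}{B_a^-}, \] with the convention $1/\infty=0$.
   Context: $X=(X_t)_{t\ge 0}$ is a regular linear continuous strong Markov process with state space $\mathbb{R}$ (a one-dimensional diffusion in the sense of Revuz–Yor, Chapter VII), conservative (infinite lifetime) and positively recurrent ($\mathbb{E}_x T_y<\infty$ for all $x,y$). $\mathbb{P}_x,\mathbb{E}_x$ denote law and expectation when $X_0=x$. For $a\in\mathbb{R}$, $T_a=\inf\{t\ge 0: X_t=a\}$. $S$ is a scale function of $X$ (continuous, strictly increasing, with $\mathbb{P}_x[T_b<T_a]=\frac{S(x)-S(a)}{S(b)-S(a)}$ for $a<x<b$), and $m$ is the speed measure associated with $S$, i.e. the Borel measure such that for $a<x<b$ and Borel $f\ge 0$, $\mathbb{E}_x\int_0^{T_a\wedge T_b}f(X_t)\,dt=\int_a^b G(a,b,x,y)f(y)\,dm(y)$, where $G(a,b,x,y)=\frac{(S(b)-S(x\vee y))(S(x\wedge y)-S(a))}{S(b)-S(a)}$. The measure $m$ charges every nonempty open set. By positive recurrence $\lim_{x\to\pm\infty}S(x)=\pm\infty$ and $m(\mathbb{R})<\infty$. For $a\in\mathbb{R}$: $B^+_a=\sup_{x\geq a} m(]x,+\infty[)(S(x)-S(a))$ and $B^-_a=\sup_{x\leq a} m(]-\infty,x[)(S(a)-S(x))$ (values in $[0,\infty]$); $\lambda_a^+=\sup\{\lambda\geq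 0: \forall x>a,\ \mathbb{E}_x e^{\lambda T_a}<\infty\}$ and $\lambda_a^-=\sup\{\lambda\geq 0: \forall x<a,\ \mathbb{E}_x e^{\lambda T_a}<\infty\}$. *)

theory Defs
  imports "HOL-Probability.Probability"
begin

text \<open>
  A process is a map \<open>X :: real \<Rightarrow> 'w \<Rightarrow> real\<close> of which only the values \<open>X t\<close> with \<open>t \<ge> 0\<close> are used,
  on a measurable space \<open>M\<close>; the measure carried by \<open>M\<close> itself plays no role, the laws being the
  measures \<open>P x\<close>. Random times take values in \<open>ennreal\<close>, and filtrations are indexed by \<open>ennreal\<close>
  so that stopping times may be infinite.
\<close>

definition hitting_time :: "(real \<Rightarrow> 'w \<Rightarrow> real) \<Rightarrow> real \<Rightarrow> 'w \<Rightarrow> ennreal" where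
  "hitting_time X a w = Inf (ennreal ` {t. 0 \<le> t \<and> X t w = a})"

definition natural_filtration :: "'w measure \<Rightarrow> (real \<Rightarrow> 'w \<Rightarrow> real) \<Rightarrow> ennreal \<Rightarrow> 'w measure" where
  "natural_filtration M X t =
     sigma (space M) {X s -` A \<inter> space M |s A. 0 \<le> s \<and> ennreal s \<le> t \<and> A \<in> sets borel}"

lemma filtration_natural_filtration: "filtration (space M) (natural_filtration M X)"
proof
  show "space (natural_filtration M X i) = space M" for i
    unfolding natural_filtration_def by (rule space_measure_of) auto
  show "sets (natural_filtration M X i) \<le> sets (natural_filtration M X j)" if "i \<le> j" for i j
  proof -
    have "{X s -` A \<inter> space M |s A. 0 \<le> s \<and> ennreal s \<le> i \<and> A \<in> sets borel}
        \<subseteq> {X s -` A \<inter> space M |s A. 0 \<le> s \<and> ennreal s \<le> j \<and> A \<in> sets borel}"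
      using that order_trans by blast
    then show ?thesis
      unfolding natural_filtration_def
      by (subst (1 2) sets_measure_of) (auto intro!: sigma_sets_mono')
  qed
qed

definition path_from :: "(real \<Rightarrow> 'w \<Rightarrow> real) \<Rightarrow> real \<Rightarrow> 'w \<Rightarrow> real \<Rightarrow> real" where
  "path_from X t w = (\<lambda>s\<in>{0..}. X (t + s) w)"

abbreviation path_space :: "(real \<Rightarrow> real) measure" where
  "path_space \<equiv> Pi\<^sub>M {0..} (\<lambda>_. borel)"

text \<open>
  The strong Markov property on \<open>{\<tau> < \<infinity>}\<close>, with \<open>path_from X \<tau>\<close> in place of shift operators. It is
  required only for stopping times of the raw natural filtration, so it holds whenever \<open>X\<close> is
  strong Markov with respect to some larger (e.g. right-continuous) filtration.
\<close>

definition strong_markov ::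
    "'w measure \<Rightarrow> (real \<Rightarrow> 'w \<Rightarrow> real) \<Rightarrow> (real \<Rightarrow> 'w measure) \<Rightarrow> bool" where
  "strong_markov M X P \<longleftrightarrow>
     (\<forall>x \<tau>. \<forall>f :: (real \<Rightarrow> real) \<Rightarrow> ennreal.
        stopping_time (natural_filtration M X) \<tau> \<longrightarrow> f \<in> borel_measurable path_space \<longrightarrow>
        (AE w in P x. \<tau> w < \<top> \<longrightarrow>
           nn_cond_exp (P x) (filtration.pre_sigma (space M) (natural_filtration M X) \<tau>)
             (\<lambda>v. f (path_from X (enn2real (\<tau> v)) v) * indicator {v. \<tau> v < \<top>} v) w
           = (\<integral>\<^sup>+ v. f (path_from X 0 v) \<partial>P (X (enn2real (\<tau> w)) w))))"

text \<open>Conservativeness is built in: \<open>X t\<close> is real-valued for all \<open>t \<ge> 0\<close>.\<close>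

locale linear_diffusion =
  fixes M :: "'w measure" and X :: "real \<Rightarrow> 'w \<Rightarrow> real" and P :: "real \<Rightarrow> 'w measure"
  assumes measurable_X: "\<And>t. 0 \<le> t \<Longrightarrow> X t \<in> borel_measurable M"
    and kernel_P: "P \<in> borel \<rightarrow>\<^sub>M prob_algebra M"
    and start: "\<And>x. AE w in P x. X 0 w = x"
    and continuous_paths: "\<And>w. w \<in> space M \<Longrightarrow> continuous_on {0..} (\<lambda>t. X t w)"
    and strong_markov: "strong_markov M X P"
    and regular: "\<And>x y. 0 < emeasure (P x) {w \<in> space M. hitting_time X y w < \<top>}"

locale positively_recurrent_diffusion = linear_diffusion +
  assumes positively_recurrent: "\<And>x y. (\<integral>\<^sup>+ w. hitting_time X y w \<partial>P x) < \<top>"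

definition scale_function ::
    "(real \<Rightarrow> 'w \<Rightarrow> real) \<Rightarrow> (real \<Rightarrow> 'w measure) \<Rightarrow> (real \<Rightarrow> real) \<Rightarrow> bool" where
  "scale_function X P S \<longleftrightarrow> continuous_on UNIV S \<and> strict_mono S \<and>
     (\<forall>a x b. a < x \<longrightarrow> x < b \<longrightarrow>
        measure (P x) {w \<in> space (P x). hitting_time X b w < hitting_time X a w}
        = (S x - S a) / (S b - S a))"

definition green :: "(real \<Rightarrow> real) \<Rightarrow> real \<Rightarrow> real \<Rightarrow> real \<Rightarrow> real \<Rightarrow> real" where
  "green S a b x y = (S b - S (max x y)) * (S (min x y) - S a) / (S b - S a)"

definition speed_measure ::
    "(real \<Rightarrow> 'w \<Rightarrow> real) \<Rightarrow> (real \<Rightarrow> 'w measure) \<Rightarrow> (real \<Rightarrow> real) \<Rightarrow> real measure \<Rightarrow> bool" where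
  "speed_measure X P S m \<longleftrightarrow> sets m = sets borel \<and>
     (\<forall>a x b. \<forall>f :: real \<Rightarrow> ennreal. a < x \<longrightarrow> x < b \<longrightarrow> f \<in> borel_measurable borel \<longrightarrow>
        (\<integral>\<^sup>+ w. (\<integral>\<^sup>+ t \<in> {t. 0 \<le> t \<and> ennreal t < min (hitting_time X a w) (hitting_time X b w)}.
                   f (X t w) \<partial>lborel) \<partial>P x)
        = (\<integral>\<^sup>+ y \<in> {a..b}. ennreal (green S a b x y) * f y \<partial>m))"

definition B_plus :: "(real \<Rightarrow> real) \<Rightarrow> real measure \<Rightarrow> real \<Rightarrow> ennreal" where
  "B_plus S m a = (SUP x\<in>{a..}. emeasure m {x<..} * ennreal (S x - S a))"

definition B_minus :: "(real \<Rightarrow> real) \<Rightarrow> real measure \<Rightarrow> real \<Rightarrow> ennreal" where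
  "B_minus S m a = (SUP x\<in>{..a}. emeasure m {..<x} * ennreal (S a - S x))"

definition exp_ennreal :: "ennreal \<Rightarrow> ennreal" where
  "exp_ennreal t = (if t = \<top> then \<top> else ennreal (exp (enn2real t)))"

definition exp_moment ::
    "(real \<Rightarrow> 'w \<Rightarrow> real) \<Rightarrow> (real \<Rightarrow> 'w measure) \<Rightarrow> real \<Rightarrow> real \<Rightarrow> real \<Rightarrow> ennreal" where
  "exp_moment X P a l x = (\<integral>\<^sup>+ w. exp_ennreal (ennreal l * hitting_time X a w) \<partial>P x)"

definition lambda_plus :: "(real \<Rightarrow> 'w \<Rightarrow> real) \<Rightarrow> (real \<Rightarrow> 'w measure) \<Rightarrow> real \<Rightarrow> ennreal" where
  "lambda_plus X P a = Sup (ennreal ` {l. 0 \<le> l \<and> (\<forall>x>a. exp_moment X P a l x < \<top>)})"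

definition lambda_minus :: "(real \<Rightarrow> 'w \<Rightarrow> real) \<Rightarrow> (real \<Rightarrow> 'w measure) \<Rightarrow> real \<Rightarrow> ennreal" where
  "lambda_minus X P a = Sup (ennreal ` {l. 0 \<le> l \<and> (\<forall>x<a. exp_moment X P a l x < \<top>)})"

end

theory Submission
  imports Defs
begin

text \<open>
  Write \<open>T\<close> for the hitting time of \<open>a\<close>, \<open>D\<close> for the half-line on one side of \<open>a\<close> and \<open>s\<close> for the
  distance to \<open>a\<close> in scale. By Kac's moment formula \<open>u n x = E x (T ^ n) / n!\<close> satisfies
  \<open>u (n + 1) = G (u n)\<close>, where \<open>G\<close> has the kernel \<open>min (s x) (s y)\<close> with respect to the speed measure
  on \<open>D\<close>, and \<open>E x (exp (\<lambda> T)) = (\<Sum>n. \<lambda> ^ n * u n x)\<close>. Since \<open>u n\<close> increases away from \<open>a\<close>,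
  \<open>u n x \<ge> (s x * m {y. s x < s y}) ^ n\<close>, which gives the upper bound \<open>1 / B\<close>. Conversely
  \<open>G (\<surd>s) \<le> 4 B \<surd>s\<close> and \<open>G 1 \<le> C \<surd>s\<close>, so \<open>u (n + 1) \<le> C (4 B) ^ n \<surd>s\<close>, which gives the lower
  bound \<open>1 / (4 B)\<close>.
\<close>

section \<open>Iterates of the Green kernel of a half-line\<close>

text \<open>Seen through \<open>s\<close>, both half-lines have the same kernel, so the analysis is
  done once, for a finite measure and a positive function \<open>s\<close> of which only the tail
  masses enter. Under the tail bound b / r, the integral of min q s times s^p is at most b q^p / (p
  (1 - p)) for 0 < p < 1. This is smallest at p = 1/2, the origin of the square root and of the 4.
  The speed measure is known only through Green functions of bounded intervals, so the kernel of a
  half-line is obtained as a limit. That the scale is unbounded and the speed measure finite on each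
  half-line is derived: the former from almost sure finiteness of hitting times, the latter from
  their finite means. All quantities are extended nonnegative, so sums and integrals may be
  exchanged before anything is known to be finite.\<close>

lemma nn_integral_inverse_sqrt:
  fixes a b :: real
  assumes "0 \<le> a" "a \<le> b"
  shows "(\<integral>\<^sup>+z. indicator {a..<b} z * ennreal (1 / (2 * sqrt z)) \<partial>lborel) = ennreal (sqrt b - sqrt a)"
proof -
  have "((\<lambda>z. 1 / (2 * sqrt z)) has_integral (sqrt b - sqrt a)) {a..b}"
  \<comment> \<open>The integrand is singular at 0 when \<open>a = 0\<close>, so the derivative is
    asked for only in the open interval.\<close>
  proof (rule fundamental_theorem_of_calculus_interior[OF \<open>a \<le> b\<close>])
    show "continuous_on {a..b} sqrt" by (intro continuous_intros)
    fix z assume "z \<in> {a<..<b}"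
    then have "z > 0" using assms by auto
    then show "(sqrt has_vector_derivative 1 / (2 * sqrt z)) (at z)"
      unfolding has_real_derivative_iff_has_vector_derivative[symmetric]
      by (auto intro!: derivative_eq_intros simp: field_simps)
  qed
  from nn_integral_has_integral_lebesgue[OF _ this] assms
  have "(\<integral>\<^sup>+z. ennreal (indicator {a..b} z * (1 / (2 * sqrt z))) \<partial>lborel) = ennreal (sqrt b - sqrt a)"
    by simp
  moreover have "AE z in lborel. z \<noteq> b" by (rule AE_lborel_singleton)
  then have "(\<integral>\<^sup>+z. indicator {a..<b} z * ennreal (1 / (2 * sqrt z)) \<partial>lborel) =
    (\<integral>\<^sup>+z. ennreal (indicator {a..b} z * (1 / (2 * sqrt z))) \<partial>lborel)"
    by (intro nn_integral_cong_AE) (auto simp: indicator_def)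
  ultimately show ?thesis by simp
qed

text \<open>The weight is the product of the tail order 1 / z and the derivative of the square
  root.\<close>

lemma nn_integral_powr_minus_three_halves:
  fixes r :: real
  assumes "0 < r"
  shows "(\<integral>\<^sup>+z. indicator {r..} z * ennreal (1 / (2 * z * sqrt z)) \<partial>lborel) = ennreal (1 / sqrt r)"
proof -
  have "(\<integral>\<^sup>+z. ennreal (1 / (2 * z * sqrt z)) * indicator {r..} z \<partial>lborel) = ennreal (0 - (- (1 / sqrt r)))"
  proof (rule nn_integral_FTC_atLeast)
    fix z assume "r \<le> z"
    then have "z > 0" using assms by auto
    then show "((\<lambda>z. - (1 / sqrt z)) has_real_derivative 1 / (2 * z * sqrt z)) (at z)"
      by (auto intro!: derivative_eq_intros simp: field_simps)
    show "0 \<le> 1 / (2 * z * sqrt z)" using \<open>z > 0\<close> by auto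
  next
    have "((\<lambda>z::real. 1 / sqrt z) \<longlongrightarrow> 0) at_top"
      by (intro real_tendsto_divide_at_top[OF tendsto_const] sqrt_at_top)
    from tendsto_minus[OF this] show "((\<lambda>z::real. - (1 / sqrt z)) \<longlongrightarrow> 0) at_top" by simp
  qed measurable
  then show ?thesis by (simp add: mult.commute)
qed

section \<open>Hardy-type estimate and growth of the Green iterates\<close>

context finite_measure
begin

text \<open>Layer-cake argument: on r < s y, the root of s y is the root of r plus the integral of 1
  / (2 sqrt z) from r to s y. After Fubini only tail masses remain; the constant part and the layers
  above r contribute at most b / sqrt r each.\<close>

lemma nn_integral_sqrt_tail_le:
  fixes s :: "'a \<Rightarrow> real" and b r :: real
  assumes [measurable]: "s \<in> borel_measurable M"
    and b: "0 \<le> b" "\<And>r. 0 < r \<Longrightarrow> emeasure M {y \<in> space M. r < s y} \<le> ennreal (b / r)"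
    and r: "0 < r"
  shows "(\<integral>\<^sup>+y. indicator {r<..} (s y) * ennreal (sqrt (s y)) \<partial>M) \<le> ennreal (2 * b / sqrt r)"
proof -
  interpret pair_sigma_finite M lborel ..
  have tail: "(\<integral>\<^sup>+y. indicator {z<..} (s y) \<partial>M) \<le> ennreal (b / z)" if "z > 0" for z
  proof -
    have "(\<integral>\<^sup>+y. indicator {z<..} (s y) \<partial>M) = (\<integral>\<^sup>+y. indicator {y \<in> space M. z < s y} y \<partial>M)"
      by (intro nn_integral_cong) (auto simp: indicator_def)
    also have "\<dots> = emeasure M {y \<in> space M. z < s y}" by simp
    finally show ?thesis using b(2)[OF that] by simp
  qed
  have split: "indicator {r<..} (s y) * ennreal (sqrt (s y)) =
      ennreal (sqrt r) * indicator {r<..} (s y) +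
      (\<integral>\<^sup>+z. indicator {r..} z * ennreal (1 / (2 * sqrt z)) * indicator {z<..} (s y) \<partial>lborel)" for y
  proof -
    have eq: "(\<integral>\<^sup>+z. indicator {r..} z * ennreal (1 / (2 * sqrt z)) * indicator {z<..} (s y) \<partial>lborel)
       = (\<integral>\<^sup>+z. indicator {r..<s y} z * ennreal (1 / (2 * sqrt z)) \<partial>lborel)"
      by (intro nn_integral_cong) (auto simp: indicator_def)
    show ?thesis
    proof (cases "r < s y")
      case True
      then show ?thesis unfolding eq using r
        by (subst nn_integral_inverse_sqrt) (auto simp flip: ennreal_plus)
    next
      case False
      then have "{r..<s y} = {}" by auto
      then show ?thesis unfolding eq using False by simp
    qed
  qed
  have "(\<integral>\<^sup>+y. indicator {r<..} (s y) * ennreal (sqrt (s y)) \<partial>M)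
    = (\<integral>\<^sup>+y. ennreal (sqrt r) * indicator {r<..} (s y) \<partial>M) +
      (\<integral>\<^sup>+y. (\<integral>\<^sup>+z. indicator {r..} z * ennreal (1 / (2 * sqrt z)) * indicator {z<..} (s y) \<partial>lborel) \<partial>M)"
    unfolding split
  proof (rule nn_integral_add)
    show "(\<lambda>y. \<integral>\<^sup>+z. indicator {r..} z * ennreal (1 / (2 * sqrt z)) * indicator {z<..} (s y) \<partial>lborel) \<in> borel_measurable M"
      \<comment> \<open>The set \<open>{z<..}\<close> moves with \<open>z\<close>; written as the
        predicate \<open>z < s y\<close>, its indicator is jointly measurable.\<close>
      unfolding greaterThan_def indicator_def mem_Collect_eq by measurable
  qed measurable
  also have "(\<integral>\<^sup>+y. ennreal (sqrt r) * indicator {r<..} (s y) \<partial>M) \<le> ennreal (sqrt r) * ennreal (b / r)"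
    by (subst nn_integral_cmult) (auto intro!: mult_left_mono tail r)
  also have "(\<integral>\<^sup>+y. (\<integral>\<^sup>+z. indicator {r..} z * ennreal (1 / (2 * sqrt z)) * indicator {z<..} (s y) \<partial>lborel) \<partial>M)
     = (\<integral>\<^sup>+z. (\<integral>\<^sup>+y. indicator {r..} z * ennreal (1 / (2 * sqrt z)) * indicator {z<..} (s y) \<partial>M) \<partial>lborel)"
  proof (rule Fubini'[symmetric])
    show "(\<lambda>(y, z). indicator {r..} z * ennreal (1 / (2 * sqrt z)) * indicator {z<..} (s y)) \<in> borel_measurable (M \<Otimes>\<^sub>M lborel)"
      unfolding greaterThan_def indicator_def mem_Collect_eq by measurable
  qed
  also have "\<dots> \<le> (\<integral>\<^sup>+z. ennreal b * (indicator {r..} z * ennreal (1 / (2 * z * sqrt z))) \<partial>lborel)"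
  proof (rule nn_integral_mono)
    fix z
    show "(\<integral>\<^sup>+y. indicator {r..} z * ennreal (1 / (2 * sqrt z)) * indicator {z<..} (s y) \<partial>M)
      \<le> ennreal b * (indicator {r..} z * ennreal (1 / (2 * z * sqrt z)))"
    proof (cases "r \<le> z")
      case True
      then have z: "z > 0" using r by auto
      have "(\<integral>\<^sup>+y. indicator {r..} z * ennreal (1 / (2 * sqrt z)) * indicator {z<..} (s y) \<partial>M)
        \<le> ennreal (1 / (2 * sqrt z)) * ennreal (b / z)"
        using True tail[OF z] by (subst nn_integral_cmult) (auto intro!: mult_left_mono)
      also have "\<dots> = ennreal b * ennreal (1 / (2 * z * sqrt z))"
        using z b by (simp add: mult_ac flip: ennreal_mult)
      finally show ?thesis using True by simp
    qed simp
  qed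
  also have "\<dots> = ennreal b * ennreal (1 / sqrt r)"
    by (subst nn_integral_cmult) (auto simp: nn_integral_powr_minus_three_halves[OF r])
  also have "ennreal (sqrt r) * ennreal (b / r) + ennreal b * ennreal (1 / sqrt r) = ennreal (2 * b / sqrt r)"
  proof -
    have "sqrt r * (b / r) + b * (1 / sqrt r) = 2 * b / sqrt r"
      using r by (simp add: field_simps)
    then show ?thesis
      using r b by (simp flip: ennreal_mult ennreal_plus)
  qed
  finally show ?thesis by (auto intro: add_mono)
qed

text \<open>The function \<open>\<surd>s\<close> is the extremal one in Muckenhoupt's form of the weighted Hardy
  inequality; this is where the constant 4 comes from.\<close>

lemma nn_integral_min_times_sqrt_le:
  fixes s :: "'a \<Rightarrow> real" and b q :: real
  assumes [measurable]: "s \<in> borel_measurable M"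
    and s: "\<And>y. y \<in> space M \<Longrightarrow> 0 < s y"
    and b: "0 \<le> b" "\<And>r. 0 < r \<Longrightarrow> emeasure M {y \<in> space M. r < s y} \<le> ennreal (b / r)"
    and q: "0 \<le> q"
  shows "(\<integral>\<^sup>+y. ennreal (min q (s y)) * ennreal (sqrt (s y)) \<partial>M) \<le> ennreal (4 * b * sqrt q)"
proof -
  interpret pair_sigma_finite M lborel ..
  have "(\<integral>\<^sup>+y. ennreal (min q (s y)) * ennreal (sqrt (s y)) \<partial>M) =
    (\<integral>\<^sup>+y. (\<integral>\<^sup>+r. indicator {0..<q} r * indicator {r<..} (s y) * ennreal (sqrt (s y)) \<partial>lborel) \<partial>M)"
  \<comment> \<open>The minimum is the length of the set of r in [0, q) with r < s y; Fubini then
    leaves a tail integral for each r.\<close>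
  proof (rule nn_integral_cong)
    fix y assume "y \<in> space M"
    then have y: "0 < s y" by (rule s)
    have "(\<integral>\<^sup>+r. indicator {0..<q} r * indicator {r<..} (s y) * ennreal (sqrt (s y)) \<partial>lborel)
      = (\<integral>\<^sup>+r. indicator {0..<min q (s y)} r * ennreal (sqrt (s y)) \<partial>lborel)"
      by (intro nn_integral_cong) (auto simp: indicator_def)
    also have "\<dots> = ennreal (min q (s y)) * ennreal (sqrt (s y))"
      using q y by (subst nn_integral_multc) (auto simp: min_def)
    finally show "ennreal (min q (s y)) * ennreal (sqrt (s y)) =
      (\<integral>\<^sup>+r. indicator {0..<q} r * indicator {r<..} (s y) * ennreal (sqrt (s y)) \<partial>lborel)" ..
  qed
  also have "\<dots> = (\<integral>\<^sup>+r. (\<integral>\<^sup>+y. indicator {0..<q} r * indicator {r<..} (s y) * ennreal (sqrt (s y)) \<partial>M) \<partial>lborel)"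
  proof (rule Fubini'[symmetric])
    show "(\<lambda>(y, r). indicator {0..<q} r * indicator {r<..} (s y) * ennreal (sqrt (s y))) \<in> borel_measurable (M \<Otimes>\<^sub>M lborel)"
      unfolding greaterThan_def indicator_def mem_Collect_eq by measurable
  qed
  also have "\<dots> \<le> (\<integral>\<^sup>+r. ennreal (4 * b) * (indicator {0..<q} r * ennreal (1 / (2 * sqrt r))) \<partial>lborel)"
  \<comment> \<open>The tail estimate needs r > 0, so the null point 0 is discarded. Elsewhere its
    bound 2 b / sqrt r is 4 b times the derivative of the square root.\<close>
  proof (rule nn_integral_mono_AE)
    have "AE r in lborel. r \<noteq> (0::real)" by (rule AE_lborel_singleton)
    then show "AE r in lborel. (\<integral>\<^sup>+y. indicator {0..<q} r * indicator {r<..} (s y) * ennreal (sqrt (s y)) \<partial>M)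
        \<le> ennreal (4 * b) * (indicator {0..<q} r * ennreal (1 / (2 * sqrt r)))"
    proof eventually_elim
      case (elim r)
      show ?case
      proof (cases "r \<in> {0..<q}")
        case True
        then have "0 < r" using elim by auto
        from nn_integral_sqrt_tail_le[OF _ b this]
        have "(\<integral>\<^sup>+y. indicator {r<..} (s y) * ennreal (sqrt (s y)) \<partial>M) \<le> ennreal (2 * b / sqrt r)" by simp
        also have "\<dots> = ennreal (4 * b) * ennreal (1 / (2 * sqrt r))"
          using b \<open>0 < r\<close> by (simp flip: ennreal_mult)
        finally show ?thesis using True by simp
      qed simp
    qed
  qed
  also have "\<dots> = ennreal (4 * b) * ennreal (sqrt q)"
    using q by (subst nn_integral_cmult) (auto simp: nn_integral_inverse_sqrt)
  also have "\<dots> = ennreal (4 * b * sqrt q)"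
    using b q by (simp add: ennreal_mult)
  finally show ?thesis .
qed

text \<open>On \<open>s x < s y\<close> the kernel equals \<open>s x\<close> and
  \<open>u n y\<close> is at least \<open>u n x\<close>, so restricting the integral to this set
  yields one factor per iteration. Monotonicity of \<open>u n\<close> along \<open>s\<close> is
  inherited directly from the kernel.\<close>

lemma green_iterates_tail_power_le:
  fixes s :: "'a \<Rightarrow> real" and u :: "nat \<Rightarrow> 'a \<Rightarrow> ennreal"
  assumes [measurable]: "s \<in> borel_measurable M"
    and u0: "\<And>x. x \<in> space M \<Longrightarrow> u 0 x = 1"
    and u_Suc: "\<And>n x. x \<in> space M \<Longrightarrow> u (Suc n) x = (\<integral>\<^sup>+y. ennreal (min (s x) (s y)) * u n y \<partial>M)"
    and x: "x \<in> space M"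
  shows "(emeasure M {y \<in> space M. s x < s y} * ennreal (s x)) ^ n \<le> u n x"
proof (induction n)
  case 0
  then show ?case using u0 x by simp
next
  case (Suc n)
  let ?A = "{y \<in> space M. s x < s y}"
  have mono: "u n x \<le> u n y" if y: "y \<in> ?A" for y
  proof (cases n)
    case 0
    then show ?thesis using u0 x y by simp
  next
    case (Suc k)
    then show ?thesis using y x
      by (auto simp: u_Suc intro!: nn_integral_mono mult_right_mono ennreal_leI)
  qed
  have "(emeasure M ?A * ennreal (s x)) ^ Suc n \<le> (emeasure M ?A * ennreal (s x)) * u n x"
    using Suc by (auto intro: mult_left_mono)
  also have "\<dots> = (\<integral>\<^sup>+y. ennreal (s x) * u n x * indicator ?A y \<partial>M)"
    by (subst nn_integral_cmult_indicator) (auto simp: mult_ac)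
  also have "\<dots> \<le> (\<integral>\<^sup>+y. ennreal (min (s x) (s y)) * u n y \<partial>M)"
    using mono by (intro nn_integral_mono) (auto simp: indicator_def intro!: mult_mono ennreal_leI)
  also have "\<dots> = u (Suc n) x" using u_Suc x by simp
  finally show ?case .
qed

text \<open>The induction starts at index 1 because the constant \<open>u 0\<close> is not
  controlled by the square root where \<open>s\<close> is small; one application of the kernel
  repairs this. \<open>C\<close> is the integral of the square root of \<open>s\<close>.\<close>

lemma green_iterates_le_sqrt:
  fixes s :: "'a \<Rightarrow> real" and u :: "nat \<Rightarrow> 'a \<Rightarrow> ennreal" and b :: real
  assumes [measurable]: "s \<in> borel_measurable M"
    and s: "\<And>y. y \<in> space M \<Longrightarrow> 0 < s y"
    and u0: "\<And>x. x \<in> space M \<Longrightarrow> u 0 x = 1"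
    and u_Suc: "\<And>n x. x \<in> space M \<Longrightarrow> u (Suc n) x = (\<integral>\<^sup>+y. ennreal (min (s x) (s y)) * u n y \<partial>M)"
    and b: "0 \<le> b" "\<And>r. 0 < r \<Longrightarrow> emeasure M {y \<in> space M. r < s y} \<le> ennreal (b / r)"
  obtains C where "0 \<le> C" "\<And>n x. x \<in> space M \<Longrightarrow> u (Suc n) x \<le> ennreal (C * (4 * b) ^ n * sqrt (s x))"
proof -
  have "(\<integral>\<^sup>+y. ennreal (sqrt (s y)) \<partial>M) \<le> (\<integral>\<^sup>+y. 1 + indicator {1<..} (s y) * ennreal (sqrt (s y)) \<partial>M)"
  \<comment> \<open>Up to height 1 the root is at most 1 and the total mass suffices; above it the
    tail estimate applies.\<close>
  proof (rule nn_integral_mono)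
    fix y
    have "ennreal (sqrt (s y)) \<le> 1" if "s y \<le> 1" using that by simp
    then show "ennreal (sqrt (s y)) \<le> 1 + indicator {1<..} (s y) * ennreal (sqrt (s y))"
      by (auto simp: indicator_def add_increasing)
  qed
  also have "\<dots> = emeasure M (space M) + (\<integral>\<^sup>+y. indicator {1<..} (s y) * ennreal (sqrt (s y)) \<partial>M)"
    by (subst nn_integral_add) auto
  also have "\<dots> \<le> emeasure M (space M) + ennreal (2 * b / sqrt 1)"
    by (intro add_left_mono nn_integral_sqrt_tail_le b) auto
  also have "\<dots> < \<top>" by (simp add: less_top[symmetric])
  finally obtain C where C: "0 \<le> C" "(\<integral>\<^sup>+y. ennreal (sqrt (s y)) \<partial>M) = ennreal C"
    unfolding less_top_ennreal by auto
  have "u (Suc n) x \<le> ennreal (C * (4 * b) ^ n * sqrt (s x))" if "x \<in> space M" for n x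
    using that
  proof (induction n arbitrary: x)
    case 0
    have "u (Suc 0) x = (\<integral>\<^sup>+y. ennreal (min (s x) (s y)) \<partial>M)"
      using 0 u0 by (auto simp: u_Suc intro!: nn_integral_cong)
    also have "\<dots> \<le> (\<integral>\<^sup>+y. ennreal (sqrt (s x)) * ennreal (sqrt (s y)) \<partial>M)"
    proof (rule nn_integral_mono)
      fix y assume "y \<in> space M"
      then have p: "0 < s x" "0 < s y" using s 0 by auto
      \<comment> \<open>A minimum is at most the geometric mean, which separates x from y.\<close>
      have "min (s x) (s y) = sqrt (min (s x) (s y)) * sqrt (min (s x) (s y))" using p by simp
      also have "\<dots> \<le> sqrt (s x) * sqrt (s y)" using p by (intro mult_mono) auto
      finally show "ennreal (min (s x) (s y)) \<le> ennreal (sqrt (s x)) * ennreal (sqrt (s y))"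
        using p by (simp add: ennreal_leI flip: ennreal_mult)
    qed
    also have "\<dots> = ennreal (C * (4 * b) ^ 0 * sqrt (s x))"
      using C s[OF 0] by (subst nn_integral_cmult) (auto simp: ennreal_mult mult.commute)
    finally show ?case .
  next
    case (Suc n)
    have "u (Suc (Suc n)) x = (\<integral>\<^sup>+y. ennreal (min (s x) (s y)) * u (Suc n) y \<partial>M)"
      by (rule u_Suc) fact
    also have "\<dots> \<le> (\<integral>\<^sup>+y. ennreal (C * (4 * b) ^ n) * (ennreal (min (s x) (s y)) * ennreal (sqrt (s y))) \<partial>M)"
    proof (rule nn_integral_mono)
      fix y assume y: "y \<in> space M"
      have "ennreal (min (s x) (s y)) * u (Suc n) y \<le> ennreal (min (s x) (s y)) * ennreal (C * (4 * b) ^ n * sqrt (s y))"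
        by (intro mult_left_mono Suc.IH y) simp
      also have "\<dots> = ennreal (C * (4 * b) ^ n) * (ennreal (min (s x) (s y)) * ennreal (sqrt (s y)))"
        using C b s[OF y] by (subst ennreal_mult) (auto simp: mult_ac)
      finally show "ennreal (min (s x) (s y)) * u (Suc n) y \<le> \<dots>" .
    qed
    also have "\<dots> \<le> ennreal (C * (4 * b) ^ n) * ennreal (4 * b * sqrt (s x))"
      using nn_integral_min_times_sqrt_le[OF _ s b, of "s x"] s[OF Suc.prems]
      by (subst nn_integral_cmult) (auto intro!: mult_left_mono)
    also have "\<dots> = ennreal (C * (4 * b) ^ Suc n * sqrt (s x))"
      using C b s[OF Suc.prems] by (simp add: mult_ac flip: ennreal_mult)
    finally show ?case .
  qed
  with C that show ?thesis by auto
qed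

text \<open>For each x the series is a power series in l with nonnegative coefficients, so growth
  bounds on \<open>u n x\<close> bound its radius of convergence. Surjectivity of \<open>s\<close>
  turns the supremum over points into a tail bound at every level r.\<close>

lemma green_iterates_radius_bounds:
  fixes s :: "'a \<Rightarrow> real" and u :: "nat \<Rightarrow> 'a \<Rightarrow> ennreal" and B :: ennreal
  assumes s_meas: "s \<in> borel_measurable M"
    and s_pos: "\<And>y. y \<in> space M \<Longrightarrow> 0 < s y"
    and s_surj: "\<And>r. 0 < r \<Longrightarrow> \<exists>x\<in>space M. s x = r"
    and u0: "\<And>x. x \<in> space M \<Longrightarrow> u 0 x = 1"
    and u_Suc: "\<And>n x. x \<in> space M \<Longrightarrow> u (Suc n) x = (\<integral>\<^sup>+y. ennreal (min (s x) (s y)) * u n y \<partial>M)"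
    and B: "B = (SUP x\<in>space M. emeasure M {y \<in> space M. s x < s y} * ennreal (s x))"
  defines "L \<equiv> Sup (ennreal ` {l. 0 \<le> l \<and> (\<forall>x\<in>space M. (\<Sum>n. ennreal (l ^ n) * u n x) < \<top>)})"
  shows "1 / (4 * B) \<le> L" "L \<le> 1 / B"
proof -
  show "L \<le> 1 / B"
    unfolding L_def
  proof (rule Sup_least, clarify)
    fix l :: real assume l: "0 \<le> l" and fin: "\<forall>x\<in>space M. (\<Sum>n. ennreal (l ^ n) * u n x) < \<top>"
    have "ennreal l * (emeasure M {y \<in> space M. s x < s y} * ennreal (s x)) \<le> 1" if x: "x \<in> space M" for x
    proof (rule ccontr)
      let ?t = "emeasure M {y \<in> space M. s x < s y} * ennreal (s x)"
      assume "\<not> ennreal l * ?t \<le> 1"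
      \<comment> \<open>If l times the tail product exceeds 1, every term of the series is at least
        1 and it diverges.\<close>
      then have "1 \<le> (ennreal l * ?t) ^ n" for n
        by (intro one_le_power) auto
      also have "(ennreal l * ?t) ^ n \<le> ennreal (l ^ n) * u n x" for n
        unfolding power_mult_distrib[of "ennreal l"] ennreal_power[OF l]
        by (intro mult_left_mono green_iterates_tail_power_le[OF s_meas u0 u_Suc x]) auto
      finally have "(\<Sum>n. 1::ennreal) \<le> (\<Sum>n. ennreal (l ^ n) * u n x)"
        by (intro suminf_le summableI)
      moreover have "(\<Sum>n. 1::ennreal) = \<top>"
      proof (rule ccontr)
        assume "(\<Sum>n. 1::ennreal) \<noteq> \<top>"
        then have "summable (\<lambda>n. 1::real)"
          by (intro summable_suminf_not_top) auto
        then show False by (simp add: summable_const_iff)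
      qed
      ultimately show False using fin x by (auto simp: top_unique)
    qed
    then have lB: "ennreal l * B \<le> 1"
      unfolding B SUP_mult_left_ennreal by (intro SUP_least) auto
    show "ennreal l \<le> 1 / B"
    \<comment> \<open>In \<open>ennreal\<close>, 1 / 0 is infinite and 1 / \<open>top\<close> is 0;
      for infinite \<open>B\<close> the bound \<open>lB\<close> forces l = 0.\<close>
    proof (cases B)
      case (real b)
      then show ?thesis using lB l
        by (cases "b = 0") (auto simp: divide_ennreal field_simps simp flip: ennreal_mult ennreal_1)
    next
      case top
      then show ?thesis using lB l by (cases "l = 0") (auto simp: ennreal_mult_top top_unique)
    qed
  qed
  show "1 / (4 * B) \<le> L"
  \<comment> \<open>Staying strictly below 1 / (4 B) makes the geometric ratio 4 b l less than 1,
    and rules out infinite \<open>B\<close>, for which the bound is 0.\<close>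
  proof (rule dense_le)
    fix z assume z: "z < 1 / (4 * B)"
    then have zt: "z \<noteq> \<top>" using not_top_less by force
    obtain l where l: "0 \<le> l" "z = ennreal l" using zt by (cases z) auto
    have "B \<noteq> \<top>" using z by (auto simp: ennreal_mult_top)
    then obtain b where b: "0 \<le> b" "B = ennreal b" by (cases B) auto
    have lb: "l * (4 * b) < 1"
    proof (cases "b = 0")
      case False
      then have "ennreal l < ennreal (1 / (4 * b))"
        using z b l by (simp add: divide_ennreal flip: ennreal_mult ennreal_1 ennreal_numeral)
      then show ?thesis using False b l by (auto simp: ennreal_less_iff field_simps)
    qed simp
    have tail: "emeasure M {y \<in> space M. r < s y} \<le> ennreal (b / r)" if r: "0 < r" for r
    proof -
      obtain x where x: "x \<in> space M" "s x = r" using s_surj[OF r] by auto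
      have "emeasure M {y \<in> space M. r < s y} * ennreal r \<le> ennreal b"
        using SUP_upper[OF x(1), of "\<lambda>x. emeasure M {y \<in> space M. s x < s y} * ennreal (s x)"] B b x by simp
      moreover obtain e where "0 \<le> e" "emeasure M {y \<in> space M. r < s y} = ennreal e"
        using emeasure_finite by (cases "emeasure M {y \<in> space M. r < s y}") auto
      ultimately show ?thesis using r b
        by (simp add: field_simps flip: ennreal_mult)
    qed
    obtain C where C: "0 \<le> C" "\<And>n x. x \<in> space M \<Longrightarrow> u (Suc n) x \<le> ennreal (C * (4 * b) ^ n * sqrt (s x))"
      using green_iterates_le_sqrt[OF s_meas s_pos u0 u_Suc b(1) tail] by metis
    have "(\<Sum>n. ennreal (l ^ n) * u n x) < \<top>" if x: "x \<in> space M" for x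
    proof -
      have "(\<Sum>n. ennreal (l ^ Suc n) * u (Suc n) x) \<le> (\<Sum>n. ennreal (l * C * sqrt (s x) * (l * (4 * b)) ^ n))"
      proof (intro suminf_le summableI)
        fix n
        have "ennreal (l ^ Suc n) * u (Suc n) x \<le> ennreal (l ^ Suc n) * ennreal (C * (4 * b) ^ n * sqrt (s x))"
          by (intro mult_left_mono C x) simp
        also have "\<dots> = ennreal (l * C * sqrt (s x) * (l * (4 * b)) ^ n)"
          using l C b s_pos[OF x] by (simp add: power_mult_distrib mult_ac flip: ennreal_mult)
        finally show "ennreal (l ^ Suc n) * u (Suc n) x \<le> \<dots>" .
      qed
      also have "\<dots> < \<top>"
        using l b C s_pos[OF x] lb unfolding less_top[symmetric]
        by (intro ennreal_suminf_neq_top summable_mult summable_geometric) auto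
      finally have "(\<Sum>n. ennreal (l ^ Suc n) * u (Suc n) x) < \<top>" .
      \<comment> \<open>The square-root bound starts at index 1, so the constant term 1 is added
        back here.\<close>
      moreover have "(\<Sum>n. ennreal (l ^ n) * u n x) = (\<Sum>n. ennreal (l ^ Suc n) * u (Suc n) x) + 1"
        using u0[OF x] by (subst suminf_offset[of _ 1]) (auto intro: summableI)
      ultimately show ?thesis by simp
    qed
    then show "z \<le> L" unfolding L_def l(2) using l(1) by (intro Sup_upper) auto
  qed
qed

end

section \<open>Hitting times of continuous paths\<close>

text \<open>Only rational times may be inspected: \<^const>\<open>hitting_time\<close> itself is not measurable on the
  uncountable product \<open>path_space\<close>, whereas this functional is, and it agrees with the hitting time
  on continuous paths.\<close>

definition avoids :: "real \<Rightarrow> real \<Rightarrow> (real \<Rightarrow> real) \<Rightarrow> bool" where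
  "avoids a t p \<longleftrightarrow> (\<exists>k::nat. \<forall>r\<in>{0..t} \<inter> \<rat>. 1 / real (Suc k) \<le> \<bar>p r - a\<bar>)"

definition hitting_functional :: "real \<Rightarrow> (real \<Rightarrow> real) \<Rightarrow> ennreal" where
  "hitting_functional a p = (SUP q\<in>{0..} \<inter> \<rat>. if avoids a q p then ennreal q else 0)"

text \<open>Asking only p r to differ from a at rational r would miss a hit at an irrational time. A
  uniform gap passes to the closure by continuity, and compactness provides such a gap for every
  path that misses a on [0, t].\<close>

lemma avoids_iff:
  assumes cont: "continuous_on {0..} p" and t: "0 \<le> t"
  shows "avoids a t p \<longleftrightarrow> (\<forall>r\<in>{0..t}. p r \<noteq> a)"
proof
  have cont': "continuous_on {0..t} (\<lambda>r. \<bar>p r - a\<bar>)"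
    by (intro continuous_intros continuous_on_subset[OF cont]) auto
  {
    assume "avoids a t p"
    then obtain k where k: "\<And>r. r \<in> {0..t} \<inter> \<rat> \<Longrightarrow> 1 / real (Suc k) \<le> \<bar>p r - a\<bar>"
      unfolding avoids_def by blast
    show "\<forall>r\<in>{0..t}. p r \<noteq> a"
    proof
      fix r assume r: "r \<in> {0..t}"
      have "1 / real (Suc k) \<le> \<bar>p r - a\<bar>"
      proof (cases "t = 0")
        case True
        then show ?thesis using k[of 0] r by auto
      next
        case False
        \<comment> \<open>A nondegenerate interval is the closure of its rational points; over the
          basis \<open>{1}\<close>, rational coordinates are just rational numbers.\<close>
        have "(\<Union>f\<in>{1 :: real} \<rightarrow> \<rat>. {f 1}) = (\<rat> :: real set)"
          by (auto intro!: exI[of _ "\<lambda>_. _"])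
        then have cl: "closure ({0..t} \<inter> \<rat>) = {0..t}"
          using closure_rationals_in_convex_set[of "{0..t}"] t False by simp
        show ?thesis
          by (rule continuous_ge_on_closure[where f = "\<lambda>r. \<bar>p r - a\<bar>" and S = "{0..t} \<inter> \<rat>"])
            (use cl cont' r k in auto)
      qed
      then have "0 < \<bar>p r - a\<bar>" by (rule less_le_trans[rotated]) simp
      then show "p r \<noteq> a" by auto
    qed
  next
    assume ne: "\<forall>r\<in>{0..t}. p r \<noteq> a"
    obtain r0 where r0: "r0 \<in> {0..t}" "\<And>r. r \<in> {0..t} \<Longrightarrow> \<bar>p r0 - a\<bar> \<le> \<bar>p r - a\<bar>"
      using continuous_attains_inf[OF _ _ cont'] t by auto
    have "0 < \<bar>p r0 - a\<bar>" using ne r0 by auto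
    then obtain k where "1 / real (Suc k) < \<bar>p r0 - a\<bar>"
      using nat_approx_posE by blast
    then show "avoids a t p"
      unfolding avoids_def using r0(2) by (intro exI[of _ k]) force
  }
qed

text \<open>The inequality is strict because the hits of a continuous path form a closed set:
  missing a up to and including t leaves room after t.\<close>

lemma less_hitting_time_iff:
  assumes cont: "continuous_on {0..} (\<lambda>t. X t w)" and t: "0 \<le> t"
  shows "ennreal t < hitting_time X a w \<longleftrightarrow> (\<forall>r\<in>{0..t}. X r w \<noteq> a)"
proof
  assume l: "ennreal t < hitting_time X a w"
  show "\<forall>r\<in>{0..t}. X r w \<noteq> a"
  proof (intro ballI notI)
    fix r assume r: "r \<in> {0..t}" "X r w = a"
    then have "hitting_time X a w \<le> ennreal r"
      unfolding hitting_time_def by (intro Inf_lower) auto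
    also have "\<dots> \<le> ennreal t" using r by (simp add: ennreal_leI)
    finally show False using l by simp
  qed
next
  assume ne: "\<forall>r\<in>{0..t}. X r w \<noteq> a"
  \<comment> \<open>Looking one unit past t makes the set of hits compact, so a first one exists and
    lies after t; if the window has none, its right end serves as \<open>e\<close>.\<close>
  define K where "K = {r \<in> {0..t + 1}. X r w = a}"
  have "compact K"
  proof -
    have "continuous_on {0..t+1} (\<lambda>t. X t w)" by (rule continuous_on_subset[OF cont]) auto
    then have "closed ({0..t+1} \<inter> (\<lambda>t. X t w) -` {a})"
      by (rule continuous_closed_preimage) auto
    moreover have "K = {0..t+1} \<inter> ({0..t+1} \<inter> (\<lambda>t. X t w) -` {a})" by (auto simp: K_def)
    ultimately show ?thesis by (metis compact_Int_closed compact_Icc)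
  qed
  obtain e where e: "t < e" "e \<le> t + 1" "\<And>r. r \<in> K \<Longrightarrow> e \<le> r"
  proof (cases "K = {}")
    case True
    then show ?thesis using that[of "t + 1"] by auto
  next
    case False
    then obtain r0 where "r0 \<in> K" "\<And>r. r \<in> K \<Longrightarrow> r0 \<le> r"
      using compact_attains_inf[OF \<open>compact K\<close>] by auto
    then show ?thesis using that[of r0] ne unfolding K_def by force
  qed
  have "ennreal t < ennreal e" using e t by (simp add: ennreal_less_iff)
  also have "ennreal e \<le> hitting_time X a w"
    unfolding hitting_time_def
  proof (rule Inf_greatest, clarify)
    fix r assume "0 \<le> r" "a = X r w"
    then show "ennreal e \<le> ennreal r"
      using e(2) e(3)[of r] by (cases "r \<le> t + 1") (auto simp: K_def ennreal_leI)
  qed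
  finally show "ennreal t < hitting_time X a w" .
qed

lemma avoids_iff_less_hitting_time:
  assumes "continuous_on {0..} (\<lambda>t. X t w)" "0 \<le> t"
  shows "avoids a t (\<lambda>t. X t w) \<longleftrightarrow> ennreal t < hitting_time X a w"
  by (simp only: avoids_iff[OF assms] less_hitting_time_iff[of X w, OF assms])

text \<open>The hitting time is the supremum of the nonnegative rationals below it, also when it is
  infinite; the value 0 in the other branch covers an immediate hit.\<close>

lemma hitting_functional_path_from_0:
  assumes cont: "continuous_on {0..} (\<lambda>t. X t w)"
  shows "hitting_functional a (path_from X 0 w) = hitting_time X a w"
proof -
  have avoids: "avoids a q (path_from X 0 w) \<longleftrightarrow> ennreal q < hitting_time X a w" if "0 \<le> q" for q
  proof -
    have "avoids a q (path_from X 0 w) \<longleftrightarrow> avoids a q (\<lambda>t. X t w)"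
      unfolding avoids_def path_from_def by simp
    then show ?thesis using avoids_iff_less_hitting_time[of X w, OF cont that] by simp
  qed
  show ?thesis
  proof (rule antisym)
    show "hitting_functional a (path_from X 0 w) \<le> hitting_time X a w"
      unfolding hitting_functional_def by (rule SUP_least) (auto simp: avoids less_imp_le)
    show "hitting_time X a w \<le> hitting_functional a (path_from X 0 w)"
    proof (rule dense_le)
      fix z assume "z < hitting_time X a w"
      then obtain z' where z': "z < z'" "z' < hitting_time X a w" using dense by blast
      obtain y where y: "0 \<le> y" "z' = ennreal y" using z' not_top_less by (cases z') force+
      obtain x where x: "0 \<le> x" "z = ennreal x" using z' not_top_less by (cases z) force+
      have "x < y" using z' x y by (simp add: ennreal_less_iff)
      then obtain q where q: "q \<in> \<rat>" "x < q" "q < y" using Rats_dense_in_real by blast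
      have "ennreal q < hitting_time X a w"
        using z'(2) q x y by (metis ennreal_leI le_less_trans less_imp_le)
      then have "ennreal q \<le> hitting_functional a (path_from X 0 w)"
        unfolding hitting_functional_def using q x avoids
        by (intro SUP_upper2[of q]) auto
      moreover have "z \<le> ennreal q" using q x by (simp add: ennreal_leI)
      ultimately show "z \<le> hitting_functional a (path_from X 0 w)" by simp
    qed
  qed
qed

lemma INF_ennreal_const_add_nonempty:
  fixes c :: ennreal
  assumes "I \<noteq> {}"
  shows "(INF i\<in>I. c + f i) = c + (INF i\<in>I. f i)"
  using continuous_at_Inf_mono[of "\<lambda>x. c + x" "f ` I"] assms
  using continuous_add[of "at_right (Inf (f ` I))", of "\<lambda>x. c" "\<lambda>x. x"]
  by (auto simp: mono_def image_comp intro!: add_left_mono)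

text \<open>Before the first hit, the hits of the shifted path are those of the original moved back
  by t. Finiteness matters since \<open>enn2real\<close> sends an infinite time to 0.\<close>

lemma hitting_functional_path_from:
  assumes cont: "continuous_on {0..} (\<lambda>t. X t w)" and t: "0 \<le> t" "ennreal t < hitting_time X a w"
    and fin: "hitting_time X a w < \<top>"
  shows "enn2real (hitting_functional a (path_from X t w)) = enn2real (hitting_time X a w) - t"
proof -
  let ?Y = "\<lambda>s. X (t + s)"
  have cont': "continuous_on {0..} (\<lambda>s. ?Y s w)"
    by (rule continuous_on_compose2[OF cont]) (use t in \<open>auto intro!: continuous_intros\<close>)
  have "path_from X t w = path_from ?Y 0 w"
    unfolding path_from_def by simp
  then have hf: "hitting_functional a (path_from X t w) = hitting_time ?Y a w"
    using hitting_functional_path_from_0[of ?Y, OF cont'] by simp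
  let ?A = "{s. 0 \<le> s \<and> ?Y s w = a}"
  have img: "{s. 0 \<le> s \<and> X s w = a} = (+) t ` ?A"
  proof (intro set_eqI iffI)
    fix s assume s: "s \<in> {s. 0 \<le> s \<and> X s w = a}"
    then have "t < s" using t less_hitting_time_iff[of X w, OF cont t(1), of a] by force
    then show "s \<in> (+) t ` ?A" using s by (intro image_eqI[of _ _ "s - t"]) auto
  qed (use t in auto)
  have "?A \<noteq> {}"
  proof
    assume "?A = {}"
    then have "hitting_time X a w = \<top>"
      by (simp only: hitting_time_def img image_empty Inf_empty)
    then show False using fin by simp
  qed
  have "hitting_time X a w = (INF s\<in>?A. ennreal t + ennreal s)"
    unfolding hitting_time_def img image_image
    by (rule INF_cong) (use t in \<open>auto simp: ennreal_plus\<close>)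
  also have "\<dots> = ennreal t + hitting_time ?Y a w"
    unfolding hitting_time_def using \<open>?A \<noteq> {}\<close> by (subst INF_ennreal_const_add_nonempty) auto
  finally have eq: "hitting_time X a w = ennreal t + hitting_time ?Y a w" .
  then have "hitting_time ?Y a w < \<top>" using fin by (simp add: ennreal_add_less_top)
  then show ?thesis
    unfolding hf eq using t by (subst enn2real_plus) auto
qed

lemma measurable_hitting_functional [measurable]:
  "hitting_functional a \<in> borel_measurable path_space"
proof -
  have "Measurable.pred path_space (avoids a q)" for q
  proof -
    have "avoids a q p \<longleftrightarrow> (\<exists>k::nat. \<forall>r\<in>{0..q} \<inter> \<rat>. 1 / real (Suc k) \<le> \<bar>p r - a\<bar>)" for p
      unfolding avoids_def ..
    moreover have "countable ({0..q} \<inter> \<rat>)" using countable_rat by (rule countable_Int2)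
    moreover have "Measurable.pred path_space (\<lambda>p. 1 / real (Suc k) \<le> \<bar>p r - a\<bar>)" if "r \<in> {0..q} \<inter> \<rat>" for r k
    proof -
      have [measurable]: "(\<lambda>p. p r) \<in> borel_measurable path_space"
        by (rule measurable_component_singleton) (use that in auto)
      show ?thesis by measurable
    qed
    ultimately show ?thesis
      by (subst measurable_cong[of _ _ "\<lambda>p. \<exists>k::nat. \<forall>r\<in>{0..q} \<inter> \<rat>. 1 / real (Suc k) \<le> \<bar>p r - a\<bar>"])
         (auto intro!: pred_intros_countable measurable_pred_countable(1))
  qed
  note [measurable] = this
  have "(\<lambda>p. SUP q\<in>{0..} \<inter> \<rat>. if avoids a q p then ennreal q else 0) \<in> borel_measurable path_space"
    by (intro borel_measurable_SUP) (auto intro: countable_rat countable_Int2)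
  then show ?thesis unfolding hitting_functional_def[abs_def] .
qed

text \<open>Fatou gives the lower estimate and domination by the limit itself the upper one; the
  limit integral may be infinite.\<close>

lemma tendsto_nn_integral_from_below:
  fixes f :: "nat \<Rightarrow> 'a \<Rightarrow> ennreal"
  assumes f: "\<And>n. f n \<in> borel_measurable M"
    and le: "\<And>n x. x \<in> space M \<Longrightarrow> f n x \<le> g x"
    and lim: "\<And>x. x \<in> space M \<Longrightarrow> (\<lambda>n. f n x) \<longlonglongrightarrow> g x"
  shows "(\<lambda>n. \<integral>\<^sup>+x. f n x \<partial>M) \<longlonglongrightarrow> (\<integral>\<^sup>+x. g x \<partial>M)"
proof (rule Liminf_eq_Limsup)
  have "(\<integral>\<^sup>+x. g x \<partial>M) = (\<integral>\<^sup>+x. liminf (\<lambda>n. f n x) \<partial>M)"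
    by (intro nn_integral_cong lim_imp_Liminf[symmetric] lim) auto
  also have "\<dots> \<le> liminf (\<lambda>n. \<integral>\<^sup>+x. f n x \<partial>M)"
    by (rule nn_integral_liminf) (rule f)
  finally have 1: "(\<integral>\<^sup>+x. g x \<partial>M) \<le> liminf (\<lambda>n. \<integral>\<^sup>+x. f n x \<partial>M)" .
  have 2: "limsup (\<lambda>n. \<integral>\<^sup>+x. f n x \<partial>M) \<le> (\<integral>\<^sup>+x. g x \<partial>M)"
    by (intro Limsup_bounded always_eventually allI nn_integral_mono le)
  have 3: "liminf (\<lambda>n. \<integral>\<^sup>+x. f n x \<partial>M) \<le> limsup (\<lambda>n. \<integral>\<^sup>+x. f n x \<partial>M)"
    by (rule Liminf_le_Limsup) simp
  show "liminf (\<lambda>n. \<integral>\<^sup>+x. f n x \<partial>M) = (\<integral>\<^sup>+x. g x \<partial>M)"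
    "limsup (\<lambda>n. \<integral>\<^sup>+x. f n x \<partial>M) = (\<integral>\<^sup>+x. g x \<partial>M)"
    using 1 2 3 by auto
qed simp

section \<open>Moments of hitting times\<close>

context linear_diffusion
begin

lemma prob_space_P: "prob_space (P x)" and sets_P [measurable_cong]: "sets (P x) = sets M"
  using measurable_space[OF kernel_P, of x] by (auto simp: space_prob_algebra)

lemma space_P [simp]: "space (P x) = space M"
  by (rule sets_eq_imp_space_eq[OF sets_P])

lemma measurable_path_from: "0 \<le> t \<Longrightarrow> path_from X t \<in> M \<rightarrow>\<^sub>M path_space"
  unfolding path_from_def[abs_def] by (intro measurable_restrict measurable_X) auto

lemma measurable_hitting_time [measurable]: "hitting_time X a \<in> borel_measurable M"
proof (rule measurable_cong[THEN iffD1])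
  show "(\<lambda>w. hitting_functional a (path_from X 0 w)) \<in> borel_measurable M"
    by (rule measurable_compose[OF measurable_path_from measurable_hitting_functional]) simp
qed (simp add: hitting_functional_path_from_0 continuous_paths)

text \<open>Time is rounded down to a grid of mesh 1 / (n + 1), where only countably many variables
  occur, and path continuity gives the limit. \<open>max 0\<close> keeps negative times out.\<close>

lemma measurable_X_pair: "(\<lambda>(t, w). X (max 0 t) w) \<in> borel_measurable (borel \<Otimes>\<^sub>M M)"
proof (rule borel_measurable_LIMSEQ_real)
  let ?k = "\<lambda>n t. nat \<lfloor>max 0 t * real (Suc n)\<rfloor>"
  let ?u = "\<lambda>n (t, w). X (real (?k n t) / real (Suc n)) w"
  show "(\<lambda>n. ?u n z) \<longlonglongrightarrow> (case z of (t, w) \<Rightarrow> X (max 0 t) w)"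
    if z: "z \<in> space (borel \<Otimes>\<^sub>M M)" for z :: "real \<times> 'w"
  proof -
    obtain t w where tw: "z = (t, w)" "w \<in> space M" using z by (auto simp: space_pair_measure)
    have "(\<lambda>n. real (?k n t) / real (Suc n)) \<longlonglongrightarrow> max 0 t"
    proof (rule tendsto_sandwich)
      show "(\<lambda>n. max 0 t - 1 / real (Suc n)) \<longlonglongrightarrow> max 0 t"
        using tendsto_diff[OF tendsto_const LIMSEQ_Suc[OF lim_1_over_n]] by simp
      show "\<forall>\<^sub>F n in sequentially. max 0 t - 1 / real (Suc n) \<le> real (?k n t) / real (Suc n)"
      proof (rule always_eventually, rule allI)
        fix n
        have "max 0 t * real (Suc n) - 1 \<le> real (?k n t)" by linarith
        from divide_right_mono[OF this, of "real (Suc n)"]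
        show "max 0 t - 1 / real (Suc n) \<le> real (?k n t) / real (Suc n)"
          by (simp add: diff_divide_distrib del: of_nat_Suc)
      qed
      show "\<forall>\<^sub>F n in sequentially. real (?k n t) / real (Suc n) \<le> max 0 t"
      proof (rule always_eventually, rule allI)
        fix n
        have "0 \<le> max 0 t * real (Suc n)" by (intro mult_nonneg_nonneg) auto
        then have "real (?k n t) \<le> max 0 t * real (Suc n)" by linarith
        then show "real (?k n t) / real (Suc n) \<le> max 0 t"
          by (simp add: divide_le_eq del: of_nat_Suc)
      qed
    qed simp
    then show ?thesis
      unfolding tw prod.case
      by (rule continuous_on_tendsto_compose[OF continuous_paths[OF tw(2)]]) auto
  qed
  show "?u n \<in> borel_measurable (borel \<Otimes>\<^sub>M M)" for n
  proof -
    have "(\<lambda>z. X (real (?k n (fst z)) / real (Suc n)) (snd z)) \<in> borel_measurable (borel \<Otimes>\<^sub>M M)"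
    proof (rule measurable_compose_countable[where f = "\<lambda>i z. X (real i / real (Suc n)) (snd z)" and g = "\<lambda>z. ?k n (fst z)"])
      show "(\<lambda>z. X (real i / real (Suc n)) (snd z)) \<in> borel_measurable (borel \<Otimes>\<^sub>M M)" for i :: nat
        by (rule measurable_compose[OF measurable_snd measurable_X]) simp
      show "(\<lambda>z. ?k n (fst z)) \<in> (borel \<Otimes>\<^sub>M M) \<rightarrow>\<^sub>M count_space UNIV" by measurable
    qed
    then show ?thesis by (simp add: case_prod_unfold)
  qed
qed

section \<open>The Markov property at a fixed time\<close>

lemma sets_natural_filtration_subset: "sets (natural_filtration M X t) \<subseteq> sets M"
  unfolding natural_filtration_def
  by (subst sets_measure_of)
     (auto intro!: sets.sigma_sets_subset measurable_sets[OF measurable_X])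

lemma space_natural_filtration [simp]: "space (natural_filtration M X t) = space M"
  using filtration.space_F[OF filtration_natural_filtration] .

lemma measurable_X_natural_filtration:
  assumes "0 \<le> r" "ennreal r \<le> t"
  shows "X r \<in> borel_measurable (natural_filtration M X t)"
proof (rule measurableI)
  fix A :: "real set" assume "A \<in> sets borel"
  then have "X r -` A \<inter> space M \<in> {X s -` A \<inter> space M |s A. 0 \<le> s \<and> ennreal s \<le> t \<and> A \<in> sets borel}"
    using assms by blast
  then show "X r -` A \<inter> space (natural_filtration M X t) \<in> sets (natural_filtration M X t)"
    unfolding space_natural_filtration unfolding natural_filtration_def
    by (subst sets_measure_of) auto
qed simp

text \<open>\<open>avoids\<close> inspects only rational times up to t, so the event not to have hit
  by t can be conditioned on at time t.\<close>

lemma sets_less_hitting_time: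
  assumes t: "0 \<le> t"
  shows "{w \<in> space M. ennreal t < hitting_time X a w} \<in> sets (natural_filtration M X (ennreal t))"
proof -
  have "{w \<in> space M. ennreal t < hitting_time X a w} =
      {w \<in> space (natural_filtration M X (ennreal t)). \<exists>k::nat. \<forall>r\<in>{0..t} \<inter> \<rat>. 1 / real (Suc k) \<le> \<bar>X r w - a\<bar>}"
    using avoids_iff_less_hitting_time[of X _ t a] continuous_paths t
    unfolding avoids_def by auto
  moreover have "Measurable.pred (natural_filtration M X (ennreal t))
      (\<lambda>w. \<exists>k::nat. \<forall>r\<in>{0..t} \<inter> \<rat>. 1 / real (Suc k) \<le> \<bar>X r w - a\<bar>)"
  proof (intro pred_intros_countable(2))
    fix k :: nat
    have "countable ({0..t} \<inter> \<rat>)" using countable_rat by (rule countable_Int2)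
    moreover have "Measurable.pred (natural_filtration M X (ennreal t)) (\<lambda>w. 1 / real (Suc k) \<le> \<bar>X r w - a\<bar>)"
      if "r \<in> {0..t} \<inter> \<rat>" for r
    proof -
      have [measurable]: "X r \<in> borel_measurable (natural_filtration M X (ennreal t))"
        using that by (intro measurable_X_natural_filtration) (auto intro: ennreal_leI)
      show ?thesis by measurable
    qed
    ultimately show "Measurable.pred (natural_filtration M X (ennreal t))
        (\<lambda>w. \<forall>r\<in>{0..t} \<inter> \<rat>. 1 / real (Suc k) \<le> \<bar>X r w - a\<bar>)"
      by (rule measurable_pred_countable(1))
  qed
  ultimately show ?thesis unfolding pred_def by simp
qed

text \<open>The strong Markov property at the constant time t, integrated over an event of the past
  so that conditional expectations disappear.\<close>

lemma markov_nn_integral: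
  fixes F :: "(real \<Rightarrow> real) \<Rightarrow> ennreal"
  assumes t: "0 \<le> t" and F[measurable]: "F \<in> borel_measurable path_space"
    and A: "A \<in> sets (natural_filtration M X (ennreal t))"
  shows "(\<integral>\<^sup>+w. indicator A w * F (path_from X t w) \<partial>P x) =
    (\<integral>\<^sup>+w. indicator A w * (\<integral>\<^sup>+v. F (path_from X 0 v) \<partial>P (X t w)) \<partial>P x)"
proof -
  interpret filtration "space M" "natural_filtration M X" by (rule filtration_natural_filtration)
  let ?\<tau> = "\<lambda>w::'w. ennreal t"
  have \<tau>: "stopping_time (natural_filtration M X) ?\<tau>" by (rule stopping_time_const)
  \<comment> \<open>For s < t this set is empty; otherwise it is \<open>A\<close>, already known at
    time t.\<close>
  have "{w \<in> A. ?\<tau> w \<le> s} \<in> sets (natural_filtration M X s)" for s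
    using A sets_F_mono[of "ennreal t" s] by (cases "ennreal t \<le> s") auto
  then have A': "A \<in> sets (pre_sigma ?\<tau>)" by (rule sets_pre_sigmaI[OF \<tau>])
  have sub: "subalgebra (P x) (pre_sigma ?\<tau>)"
    unfolding subalgebra_def
  proof
    show "sets (pre_sigma ?\<tau>) \<subseteq> sets (P x)"
    proof
      fix C assume "C \<in> sets (pre_sigma ?\<tau>)"
      from sets_pre_sigmaD[OF \<tau> this, of "ennreal t"] show "C \<in> sets (P x)"
        using sets_natural_filtration_subset sets_P by auto
    qed
  qed (simp add: space_pre_sigma)
  interpret prob_space "P x" by (rule prob_space_P)
  interpret finite_measure_subalgebra "P x" "pre_sigma ?\<tau>" by standard (rule sub)
  note [measurable] = measurable_path_from[OF t]
  have G: "(\<lambda>v. F (path_from X t v)) \<in> borel_measurable (P x)" by measurable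
  have "(\<integral>\<^sup>+w. indicator A w * F (path_from X t w) \<partial>P x) =
     (\<integral>\<^sup>+w. indicator A w * nn_cond_exp (P x) (pre_sigma ?\<tau>) (\<lambda>v. F (path_from X t v)) w \<partial>P x)"
    using A' by (intro nn_cond_exp_intg[symmetric] G) auto
  also have "\<dots> = (\<integral>\<^sup>+w. indicator A w * (\<integral>\<^sup>+v. F (path_from X 0 v) \<partial>P (X t w)) \<partial>P x)"
  proof (rule nn_integral_cong_AE)
    have "AE w in P x. ?\<tau> w < \<top> \<longrightarrow>
           nn_cond_exp (P x) (pre_sigma ?\<tau>)
             (\<lambda>v. F (path_from X (enn2real (?\<tau> v)) v) * indicator {v. ?\<tau> v < \<top>} v) w
           = (\<integral>\<^sup>+ v. F (path_from X 0 v) \<partial>P (X (enn2real (?\<tau> w)) w))"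
      using strong_markov \<tau> F unfolding strong_markov_def by blast
    then have "AE w in P x. nn_cond_exp (P x) (pre_sigma ?\<tau>) (\<lambda>v. F (path_from X t v)) w =
        (\<integral>\<^sup>+v. F (path_from X 0 v) \<partial>P (X t w))"
      using t by simp
    then show "AE w in P x. indicator A w * nn_cond_exp (P x) (pre_sigma ?\<tau>) (\<lambda>v. F (path_from X t v)) w =
      indicator A w * (\<integral>\<^sup>+v. F (path_from X 0 v) \<partial>P (X t w))"
      by eventually_elim simp
  qed
  finally show ?thesis .
qed

text \<open>A continuous path is bounded on [0, t], so levels beyond its bound are not reached by
  then.\<close>

lemma eventually_less_hitting_time:
  assumes b: "filterlim (\<lambda>n. \<bar>b n\<bar>) at_top F" and w: "w \<in> space M" and t: "0 \<le> t"
  shows "\<forall>\<^sub>F n in F. ennreal t < hitting_time X (b n) w"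
proof -
  have cont: "continuous_on {0..t} (\<lambda>t. X t w)"
    by (rule continuous_on_subset[OF continuous_paths[OF w]]) auto
  have "bounded ((\<lambda>t. X t w) ` {0..t})"
    by (intro compact_imp_bounded compact_continuous_image cont) auto
  then obtain K where K: "\<And>r. r \<in> {0..t} \<Longrightarrow> \<bar>X r w\<bar> \<le> K"
    unfolding bounded_iff by (metis imageI real_norm_def)
  have "\<forall>\<^sub>F n in F. K < \<bar>b n\<bar>" using b by (auto simp: filterlim_at_top_dense)
  then show ?thesis
  proof eventually_elim
    case (elim n)
    then show ?case using K
      by (subst less_hitting_time_iff[of X w, OF continuous_paths[OF w] t]) force
  qed
qed

text \<open>Dividing by n! removes the combinatorial factor from Kac's recursion. Reading infinite
  times as 0 affects only a null set under positive recurrence.\<close>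

definition hitting_moment :: "real \<Rightarrow> nat \<Rightarrow> real \<Rightarrow> ennreal" where
  "hitting_moment a n x = (\<integral>\<^sup>+w. ennreal (enn2real (hitting_time X a w) ^ n / fact n) \<partial>P x)"

lemma hitting_moment_0: "hitting_moment a 0 x = 1"
  using prob_space.emeasure_space_1[OF prob_space_P, of x] by (simp add: hitting_moment_def)

lemma measurable_hitting_moment [measurable]: "hitting_moment a n \<in> borel_measurable borel"
  unfolding hitting_moment_def[abs_def]
  by (rule nn_integral_measurable_subprob_algebra2[OF _ measurable_prob_algebraD[OF kernel_P]]) measurable

lemma measurable_occupation:
  fixes f :: "real \<Rightarrow> ennreal" and T :: "'w \<Rightarrow> ennreal"
  assumes [measurable]: "f \<in> borel_measurable borel" "T \<in> borel_measurable M"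
  shows "(\<lambda>(t, w). f (X (max 0 t) w) * indicator {t. 0 \<le> t \<and> ennreal t < T w} t)
    \<in> borel_measurable (lborel \<Otimes>\<^sub>M M)"
proof -
  define g where "g z = f (X (max 0 (fst z)) (snd z))" for z
  have [measurable]: "g \<in> borel_measurable (borel \<Otimes>\<^sub>M M)"
    using measurable_compose[OF measurable_X_pair assms(1)] by (simp add: g_def[abs_def] case_prod_unfold)
  have "(\<lambda>z. g z * (if 0 \<le> fst z \<and> ennreal (fst z) < T (snd z) then 1 else 0))
    \<in> borel_measurable (borel \<Otimes>\<^sub>M M)"
    by measurable
  then show ?thesis by (simp add: g_def indicator_def of_bool_def case_prod_unfold cong: measurable_cong_sets)
qed

end

text \<open>Integrating the residual time over the elapsed time raises the normalized power by one;
  this is the analytic half of Kac's recursion.\<close>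

lemma nn_integral_power_residual:
  fixes r :: real
  assumes r: "0 \<le> r"
  shows "(\<integral>\<^sup>+t. indicator {0..<r} t * ennreal ((r - t) ^ n / fact n) \<partial>lborel) = ennreal (r ^ Suc n / fact (Suc n))"
proof -
  have "(\<integral>\<^sup>+t. ennreal ((r - t) ^ n / fact n) * indicator {0..r} t \<partial>lborel) =
      ennreal (- ((r - r) ^ Suc n / fact (Suc n)) - - ((r - 0) ^ Suc n / fact (Suc n)))"
  proof (rule nn_integral_FTC_Icc)
    fix t assume "t \<in> {0..r}"
    then show "0 \<le> (r - t) ^ n / fact n" by simp
    have "((\<lambda>t. - ((r - t) ^ Suc n / fact (Suc n))) has_real_derivative
        - (real (Suc n) * (r - t) ^ n * (0 - 1) / fact (Suc n))) (at t)"
      using DERIV_power_Suc[of "\<lambda>t. r - t" "0 - 1" t UNIV n]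
      by (intro DERIV_minus DERIV_cdivide) (auto intro!: derivative_eq_intros simp: mult_ac simp del: power_Suc of_nat_Suc)
    moreover have "- (real (Suc n) * (r - t) ^ n * (0 - 1) / fact (Suc n)) = (r - t) ^ n / fact n"
      by (simp add: fact_Suc del: of_nat_Suc)
    ultimately show "((\<lambda>t. - ((r - t) ^ Suc n / fact (Suc n))) has_real_derivative (r - t) ^ n / fact n) (at t)"
      by simp
  qed (use r in auto)
  moreover have "AE t in lborel. t \<noteq> r" by (rule AE_lborel_singleton)
  then have "(\<integral>\<^sup>+t. indicator {0..<r} t * ennreal ((r - t) ^ n / fact n) \<partial>lborel) =
      (\<integral>\<^sup>+t. ennreal ((r - t) ^ n / fact n) * indicator {0..r} t \<partial>lborel)"
    by (intro nn_integral_cong_AE) (auto simp: indicator_def)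
  ultimately show ?thesis by simp
qed

section \<open>Kac's recursion and the exponential series\<close>

context positively_recurrent_diffusion
begin

lemma hitting_time_finite_AE: "AE w in P x. hitting_time X a w < \<top>"
proof -
  have "AE w in P x. hitting_time X a w \<noteq> \<infinity>"
    by (rule nn_integral_PInf_AE) (use positively_recurrent[where x = x and y = a] in auto)
  then show ?thesis by (simp add: less_top)
qed

abbreviation occupation :: "real \<Rightarrow> ('a \<Rightarrow> ennreal) \<Rightarrow> (real \<Rightarrow> ennreal) \<Rightarrow> ennreal" where
  "occupation x T f \<equiv> \<integral>\<^sup>+w. (\<integral>\<^sup>+t\<in>{t. 0 \<le> t \<and> ennreal t < T w}. f (X t w) \<partial>lborel) \<partial>P x"

text \<open>The version with \<open>max 0\<close> is the one known to be jointly measurable, as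
  Fubini requires.\<close>

lemma occupation_max_eq:
  "(\<integral>\<^sup>+t\<in>{t. 0 \<le> t \<and> ennreal t < T w}. f (X t w) \<partial>lborel) =
   (\<integral>\<^sup>+t\<in>{t. 0 \<le> t \<and> ennreal t < T w}. f (X (max 0 t) w) \<partial>lborel)"
  by (intro nn_integral_cong) (auto simp: indicator_def)

text \<open>Kac's moment formula; by the Markov property at time \<open>t\<close>, the residual time \<open>T - t\<close> on
  \<open>t < T\<close> has the law of \<open>T\<close> started from \<open>X t\<close>.\<close>

lemma hitting_moment_Suc:
  "hitting_moment a (Suc n) x = occupation x (hitting_time X a) (hitting_moment a n)"
proof -
  let ?T = "hitting_time X a"
  let ?ind = "\<lambda>t w. indicator {t. 0 \<le> t \<and> ennreal t < ?T w} t :: ennreal"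
  interpret prob_space "P x" by (rule prob_space_P)
  interpret pair_sigma_finite lborel "P x" ..
  have A: "(\<lambda>(t, w). hitting_moment a n (X (max 0 t) w) * ?ind t w) \<in> borel_measurable (lborel \<Otimes>\<^sub>M P x)"
    using measurable_occupation[OF measurable_hitting_moment measurable_hitting_time]
    by (simp cong: measurable_cong_sets)
  have B: "(\<lambda>(t, w). ennreal ((enn2real (?T w) - t) ^ n / fact n) * ?ind t w) \<in> borel_measurable (lborel \<Otimes>\<^sub>M P x)"
  proof -
    have "(\<lambda>z. ennreal ((enn2real (?T (snd z)) - fst z) ^ n / fact n) *
        (if 0 \<le> fst z \<and> ennreal (fst z) < ?T (snd z) then 1 else 0)) \<in> borel_measurable (borel \<Otimes>\<^sub>M M)"
      by measurable
    then show ?thesis by (simp add: indicator_def of_bool_def case_prod_unfold cong: measurable_cong_sets)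
  qed
  \<comment> \<open>The Markov property takes only functionals measurable on
    \<open>path_space\<close>, hence \<open>hitting_functional\<close> in place of
    \<open>hitting_time\<close>.\<close>
  define F where "F p = ennreal (enn2real (hitting_functional a p) ^ n / fact n)" for p
  have F[measurable]: "F \<in> borel_measurable path_space" unfolding F_def[abs_def] by measurable
  have moment: "hitting_moment a n y = (\<integral>\<^sup>+v. F (path_from X 0 v) \<partial>P y)" for y
    unfolding hitting_moment_def F_def
    by (intro nn_integral_cong) (simp add: hitting_functional_path_from_0 continuous_paths)
  have key: "(\<integral>\<^sup>+w. hitting_moment a n (X (max 0 t) w) * ?ind t w \<partial>P x) =
    (\<integral>\<^sup>+w. ennreal ((enn2real (?T w) - t) ^ n / fact n) * ?ind t w \<partial>P x)" for t
  proof (cases "0 \<le> t")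
    case True
    let ?A = "{w \<in> space M. ennreal t < ?T w}"
    have "(\<integral>\<^sup>+w. hitting_moment a n (X (max 0 t) w) * ?ind t w \<partial>P x) =
        (\<integral>\<^sup>+w. indicator ?A w * (\<integral>\<^sup>+v. F (path_from X 0 v) \<partial>P (X t w)) \<partial>P x)"
      unfolding moment using True by (intro nn_integral_cong) (auto simp: indicator_def)
    also have "\<dots> = (\<integral>\<^sup>+w. indicator ?A w * F (path_from X t w) \<partial>P x)"
      by (rule markov_nn_integral[OF True F sets_less_hitting_time[OF True], symmetric])
    also have "\<dots> = (\<integral>\<^sup>+w. ennreal ((enn2real (?T w) - t) ^ n / fact n) * ?ind t w \<partial>P x)"
    proof (rule nn_integral_cong_AE)
      show "AE w in P x. indicator ?A w * F (path_from X t w) = ennreal ((enn2real (?T w) - t) ^ n / fact n) * ?ind t w"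
        using hitting_time_finite_AE[of a x] AE_space
      proof eventually_elim
        case (elim w)
        then have w: "w \<in> space M" by simp
        show ?case
          using hitting_functional_path_from[of X w t a, OF continuous_paths[OF w] True _ elim(1)] w True
          by (auto simp: indicator_def F_def)
      qed
    qed
    finally show ?thesis .
  qed simp
  \<comment> \<open>Fubini moves time outside, where the Markov property applies at each fixed t,
    and then back inside.\<close>
  have "occupation x ?T (hitting_moment a n) =
      (\<integral>\<^sup>+w. (\<integral>\<^sup>+t. hitting_moment a n (X (max 0 t) w) * ?ind t w \<partial>lborel) \<partial>P x)"
    by (subst occupation_max_eq) (rule refl)
  also have "\<dots> = (\<integral>\<^sup>+t. (\<integral>\<^sup>+w. hitting_moment a n (X (max 0 t) w) * ?ind t w \<partial>P x) \<partial>lborel)"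
    using Fubini'[OF A] by simp
  also have "\<dots> = (\<integral>\<^sup>+t. (\<integral>\<^sup>+w. ennreal ((enn2real (?T w) - t) ^ n / fact n) * ?ind t w \<partial>P x) \<partial>lborel)"
    by (simp only: key)
  also have "\<dots> = (\<integral>\<^sup>+w. (\<integral>\<^sup>+t. ennreal ((enn2real (?T w) - t) ^ n / fact n) * ?ind t w \<partial>lborel) \<partial>P x)"
    using Fubini'[OF B] by simp
  also have "\<dots> = hitting_moment a (Suc n) x"
    unfolding hitting_moment_def
  proof (rule nn_integral_cong_AE)
    show "AE w in P x. (\<integral>\<^sup>+t. ennreal ((enn2real (?T w) - t) ^ n / fact n) * ?ind t w \<partial>lborel) =
        ennreal (enn2real (?T w) ^ Suc n / fact (Suc n))"
      using hitting_time_finite_AE[of a x]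
    proof eventually_elim
      case (elim w)
      then obtain r where r: "0 \<le> r" "?T w = ennreal r" unfolding less_top_ennreal by auto
      have "(\<integral>\<^sup>+t. ennreal ((enn2real (?T w) - t) ^ n / fact n) * ?ind t w \<partial>lborel) =
          (\<integral>\<^sup>+t. indicator {0..<r} t * ennreal ((r - t) ^ n / fact n) \<partial>lborel)"
        using r by (intro nn_integral_cong) (auto simp: indicator_def ennreal_less_iff)
      then show ?case using nn_integral_power_residual[OF r(1)] r by simp
    qed
  qed
  finally show ?thesis ..
qed

text \<open>The exponential series is expanded path by path, almost surely at a finite time, and
  integrated termwise by nonnegativity.\<close>

lemma exp_moment_eq_suminf:
  assumes l: "0 \<le> l"
  shows "exp_moment X P a l x = (\<Sum>n. ennreal (l ^ n) * hitting_moment a n x)"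
proof -
  have "exp_moment X P a l x =
    (\<integral>\<^sup>+w. (\<Sum>n. ennreal (l ^ n) * ennreal (enn2real (hitting_time X a w) ^ n / fact n)) \<partial>P x)"
    unfolding exp_moment_def
  proof (rule nn_integral_cong_AE)
    show "AE w in P x. exp_ennreal (ennreal l * hitting_time X a w) =
      (\<Sum>n. ennreal (l ^ n) * ennreal (enn2real (hitting_time X a w) ^ n / fact n))"
      using hitting_time_finite_AE[of a x]
    proof eventually_elim
      case (elim w)
      then obtain r where r: "0 \<le> r" "hitting_time X a w = ennreal r" unfolding less_top_ennreal by auto
      have "(\<lambda>n. (l * r) ^ n / fact n) sums exp (l * r)"
        using exp_converges[of "l * r"] by (simp add: divide_inverse mult.commute)
      then have "(\<Sum>n. ennreal ((l * r) ^ n / fact n)) = ennreal (exp (l * r))"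
        using l r by (intro suminf_ennreal_eq) auto
      moreover have "ennreal (l ^ n) * ennreal (r ^ n / fact n) = ennreal ((l * r) ^ n / fact n)" for n
        using l r by (subst ennreal_mult[symmetric]) (auto simp: power_mult_distrib)
      moreover have "exp_ennreal (ennreal l * ennreal r) = ennreal (exp (l * r))"
        unfolding ennreal_mult[OF l r(1), symmetric] exp_ennreal_def using l r by simp
      ultimately show ?case
        by (simp only: r(2) enn2real_ennreal[OF r(1)])
    qed
  qed
  also have "\<dots> = (\<Sum>n. ennreal (l ^ n) * hitting_moment a n x)"
    unfolding hitting_moment_def
    by (subst nn_integral_suminf) (auto simp: nn_integral_cmult)
  finally show ?thesis .
qed

section \<open>From bounded intervals to half-lines\<close>

lemma tendsto_prob_hitting_time_less:
  assumes b: "filterlim (\<lambda>n. \<bar>b n\<bar>) at_top sequentially"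
  shows "(\<lambda>n. measure (P x) {w \<in> space (P x). hitting_time X a w < hitting_time X (b n) w}) \<longlonglongrightarrow> 1"
proof -
  interpret prob_space "P x" by (rule prob_space_P)
  let ?E = "\<lambda>n. {w \<in> space (P x). hitting_time X a w < hitting_time X (b n) w}"
  let ?E' = "{w \<in> space (P x). hitting_time X a w < \<top>}"
  have [measurable]: "?E n \<in> sets (P x)" "?E' \<in> sets (P x)" for n by measurable
  \<comment> \<open>On each path that hits \<open>a\<close>, the time to reach \<open>b n\<close>
    eventually exceeds this finite hitting time.\<close>
  have "(\<lambda>n. \<integral>\<^sup>+w. indicator (?E n) w \<partial>P x) \<longlonglongrightarrow> (\<integral>\<^sup>+w. indicator ?E' w \<partial>P x)"
  proof (rule tendsto_nn_integral_from_below)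
    fix w assume w: "w \<in> space (P x)"
    show "indicator (?E n) w \<le> (indicator ?E' w :: ennreal)" for n
      by (auto simp: indicator_def less_top[symmetric])
    show "(\<lambda>n. indicator (?E n) w :: ennreal) \<longlonglongrightarrow> indicator ?E' w"
    proof (cases "hitting_time X a w < \<top>")
      case True
      then obtain r where r: "0 \<le> r" "hitting_time X a w = ennreal r" unfolding less_top_ennreal by auto
      have "\<forall>\<^sub>F n in sequentially. ennreal r < hitting_time X (b n) w"
        by (rule eventually_less_hitting_time[OF b _ r(1)]) (use w in simp)
      then have "\<forall>\<^sub>F n in sequentially. indicator (?E n) w = (indicator ?E' w :: ennreal)"
        by eventually_elim (use w r in \<open>auto simp: indicator_def\<close>)
      then show ?thesis by (rule tendsto_eventually)
    next
      case False
      then have "indicator (?E n) w = (0 :: ennreal)" for n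
        by (auto simp: indicator_def less_top[symmetric])
      then show ?thesis using False by simp
    qed
  qed measurable
  moreover have "emeasure (P x) ?E' = 1"
    using hitting_time_finite_AE[of a x] by (intro emeasure_eq_1_AE) auto
  ultimately show ?thesis by (simp add: emeasure_eq_measure)
qed

text \<open>At a fixed time t, stopping at \<open>b n\<close> has no effect once n is large. The
  convergence lemma is used twice, for the time integral and for the expectation.\<close>

lemma tendsto_occupation_min:
  assumes b: "filterlim (\<lambda>n. \<bar>b n\<bar>) at_top sequentially" and f[measurable]: "f \<in> borel_measurable borel"
  shows "(\<lambda>n. occupation x (\<lambda>w. min (hitting_time X a w) (hitting_time X (b n) w)) f)
    \<longlonglongrightarrow> occupation x (hitting_time X a) f"
proof -
  let ?T = "\<lambda>n w. min (hitting_time X a w) (hitting_time X (b n) w)"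
  let ?g = "\<lambda>T w t. f (X (max 0 t) w) * indicator {t. 0 \<le> t \<and> ennreal t < T w} t"
  have meas: "(\<lambda>z. ?g T (snd z) (fst z)) \<in> borel_measurable (lborel \<Otimes>\<^sub>M M)" if [measurable]: "T \<in> borel_measurable M" for T
    using measurable_occupation[OF f that] by (simp add: case_prod_unfold)
  have inner: "?g T w \<in> borel_measurable lborel" if "T \<in> borel_measurable M" "w \<in> space M" for T w
    using measurable_compose[OF measurable_Pair2'[OF that(2), of lborel] meas[OF that(1)]] by simp
  have outer: "(\<lambda>w. \<integral>\<^sup>+t. ?g T w t \<partial>lborel) \<in> borel_measurable (P x)" if "T \<in> borel_measurable M" for T
  proof -
    have "(\<lambda>z. ?g T (fst z) (snd z)) \<in> borel_measurable (M \<Otimes>\<^sub>M lborel)"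
      using measurable_compose[OF measurable_pair_swap' meas[OF that]] by (simp add: case_prod_unfold)
    from lborel.borel_measurable_nn_integral_fst[OF this] show ?thesis
      by (simp cong: measurable_cong_sets)
  qed
  have T[measurable]: "?T n \<in> borel_measurable M" for n by measurable
  have le: "?g (?T n) w t \<le> ?g (hitting_time X a) w t" for n w t
    by (auto simp: indicator_def)
  have eq: "occupation x T f = (\<integral>\<^sup>+w. (\<integral>\<^sup>+t. ?g T w t \<partial>lborel) \<partial>P x)" for T
    by (subst occupation_max_eq) (rule refl)
  show ?thesis
    unfolding eq
  proof (rule tendsto_nn_integral_from_below)
    fix w assume "w \<in> space (P x)"
    then have w: "w \<in> space M" by simp
    show "(\<integral>\<^sup>+t. ?g (?T n) w t \<partial>lborel) \<le> (\<integral>\<^sup>+t. ?g (hitting_time X a) w t \<partial>lborel)" for n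
      by (intro nn_integral_mono le)
    show "(\<lambda>n. \<integral>\<^sup>+t. ?g (?T n) w t \<partial>lborel) \<longlonglongrightarrow> (\<integral>\<^sup>+t. ?g (hitting_time X a) w t \<partial>lborel)"
    proof (rule tendsto_nn_integral_from_below)
      fix t
      show "?g (?T n) w \<in> borel_measurable lborel" for n by (rule inner[OF T w])
      show "?g (?T n) w t \<le> ?g (hitting_time X a) w t" for n by (rule le)
      show "(\<lambda>n. ?g (?T n) w t) \<longlonglongrightarrow> ?g (hitting_time X a) w t"
      proof (cases "0 \<le> t")
        case True
        from eventually_less_hitting_time[OF b w this]
        have "\<forall>\<^sub>F n in sequentially. ?g (?T n) w t = ?g (hitting_time X a) w t"
          by eventually_elim (auto simp: indicator_def)
        then show ?thesis by (rule tendsto_eventually)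
      qed simp
    qed
  qed (rule outer[OF T])
qed

text \<open>Letting the far end \<open>b n\<close> of the interval escape turns the Green function of the interval
  into that of the half-line \<open>D\<close>, where \<open>s\<close> is the distance to \<open>a\<close> in scale and \<open>c n = s (b n)\<close>.
  The scale is unbounded because the probability of reaching \<open>b n\<close> before \<open>a\<close> tends to 0.\<close>

lemma half_line_limits:
  fixes s :: "real \<Rightarrow> real" and c b :: "nat \<Rightarrow> real"
  assumes b: "filterlim (\<lambda>n. \<bar>b n\<bar>) at_top sequentially"
    and m: "sets m = sets borel" and D: "D \<in> sets borel" and s: "s \<in> borel_measurable borel"
    and sx: "0 < s x" and c: "\<And>n. 0 < c n"
    and hit: "\<And>n. measure (P x) {w \<in> space (P x). hitting_time X a w < hitting_time X (b n) w} \<le> 1 - s x / c n"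
    and green: "\<And>n f. f \<in> borel_measurable borel \<Longrightarrow>
      occupation x (\<lambda>w. min (hitting_time X a w) (hitting_time X (b n) w)) f =
      (\<integral>\<^sup>+y\<in>D. ennreal (min (s x) (s y) * max 0 (1 - max (s x) (s y) / c n)) * f y \<partial>m)"
    and s_pos: "\<And>y. y \<in> D \<Longrightarrow> 0 < s y"
  shows "filterlim c at_top sequentially"
    and "\<And>f. f \<in> borel_measurable borel \<Longrightarrow>
      occupation x (hitting_time X a) f = (\<integral>\<^sup>+y\<in>D. ennreal (min (s x) (s y)) * f y \<partial>m)"
proof -
  have ratio: "(\<lambda>n. s x / c n) \<longlonglongrightarrow> 0"
  proof -
    let ?p = "\<lambda>n. measure (P x) {w \<in> space (P x). hitting_time X a w < hitting_time X (b n) w}"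
    have lim: "(\<lambda>n. 1 - ?p n) \<longlonglongrightarrow> 0"
      using tendsto_diff[OF tendsto_const tendsto_prob_hitting_time_less[OF b], of 1] by simp
    have le: "s x / c n \<le> 1 - ?p n" for n using hit[of n] by linarith
    have "0 \<le> s x / c n" for n using sx c[of n] by simp
    then show ?thesis
      by (intro tendsto_sandwich[OF _ _ tendsto_const lim] always_eventually allI le)
  qed
  have "filterlim (\<lambda>n. s x * inverse (s x / c n)) at_top sequentially"
    using ratio sx c
    by (intro filterlim_tendsto_pos_mult_at_top[OF tendsto_const] filterlim_inverse_at_top) auto
  then show c_top: "filterlim c at_top sequentially"
    using sx c by (simp add: field_simps)
  fix f :: "real \<Rightarrow> ennreal" assume f[measurable]: "f \<in> borel_measurable borel"
  note [measurable] = s D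
  note [measurable_cong] = m
  \<comment> \<open>An interval Green function is min (s x) (s y) times 1 - max (s x) (s y) / c n.
    Cutting this factor at 0 extends it by 0 past the far end, so all integrals run over
    \<open>D\<close>; the factor is at most 1 and tends to 1.\<close>
  let ?h = "\<lambda>n y. ennreal (min (s x) (s y) * max 0 (1 - max (s x) (s y) / c n)) * f y * indicator D y"
  have "(\<lambda>n. \<integral>\<^sup>+y. ?h n y \<partial>m) \<longlonglongrightarrow> (\<integral>\<^sup>+y. ennreal (min (s x) (s y)) * f y * indicator D y \<partial>m)"
  proof (rule tendsto_nn_integral_from_below)
    fix y
    have lim: "(\<lambda>n. max 0 (1 - max (s x) (s y) / c n)) \<longlonglongrightarrow> 1"
    proof -
      have "(\<lambda>n. max (s x) (s y) / c n) \<longlonglongrightarrow> 0"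
        by (rule real_tendsto_divide_at_top[OF tendsto_const c_top])
      from tendsto_max[OF tendsto_const tendsto_diff[OF tendsto_const this], of 0 1]
      show ?thesis by simp
    qed
    show "?h n y \<le> ennreal (min (s x) (s y)) * f y * indicator D y" for n
    proof (cases "y \<in> D")
      case True
      then have pos: "0 < min (s x) (s y)" using s_pos sx by simp
      have "max 0 (1 - max (s x) (s y) / c n) \<le> 1" using sx c[of n] by (simp add: max_def)
      from mult_left_mono[OF this, of "min (s x) (s y)"] pos
      show ?thesis by (intro mult_right_mono ennreal_leI) auto
    qed simp
    show "(\<lambda>n. ?h n y) \<longlonglongrightarrow> ennreal (min (s x) (s y)) * f y * indicator D y"
    proof (cases "y \<in> D")
      case True
      then have pos: "0 < min (s x) (s y)" using s_pos sx by simp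
      have "(\<lambda>n. min (s x) (s y) * max 0 (1 - max (s x) (s y) / c n)) \<longlonglongrightarrow> min (s x) (s y) * 1"
        by (intro tendsto_mult tendsto_const lim)
      then have "(\<lambda>n. ennreal (min (s x) (s y) * max 0 (1 - max (s x) (s y) / c n))) \<longlonglongrightarrow> ennreal (min (s x) (s y))"
        by (intro tendsto_ennrealI) simp
      from tendsto_mult_ennreal[OF this tendsto_const, of "f y"] pos True show ?thesis
        by (auto simp: min_def split: if_splits)
    qed simp
  qed measurable
  moreover have "(\<lambda>n. \<integral>\<^sup>+y. ?h n y \<partial>m) \<longlonglongrightarrow> occupation x (hitting_time X a) f"
    using tendsto_occupation_min[OF b f, of x a] by (simp only: green[OF f])
  ultimately show "occupation x (hitting_time X a) f = (\<integral>\<^sup>+y\<in>D. ennreal (min (s x) (s y)) * f y \<partial>m)"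
    by (rule LIMSEQ_unique[rotated])
qed

end

section \<open>The two half-lines\<close>

context positively_recurrent_diffusion
begin

text \<open>On the restriction of \<open>m\<close> to \<open>D\<close>, Kac's recursion and the
  half-line occupation formula make the hitting moments the iterates of the abstract kernel.\<close>

lemma exp_moment_radius_bounds:
  fixes s :: "real \<Rightarrow> real"
  assumes m: "sets m = sets borel" and D: "D \<in> sets borel" and s: "s \<in> borel_measurable borel"
    and s_pos: "\<And>y. y \<in> D \<Longrightarrow> 0 < s y"
    and s_surj: "\<And>r. 0 < r \<Longrightarrow> \<exists>x\<in>D. s x = r"
    and fin: "emeasure m D < \<top>"
    and green: "\<And>x f. x \<in> D \<Longrightarrow> f \<in> borel_measurable borel \<Longrightarrow>
      occupation x (hitting_time X a) f = (\<integral>\<^sup>+y\<in>D. ennreal (min (s x) (s y)) * f y \<partial>m)"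
    and B: "B = (SUP x\<in>D. emeasure m {y \<in> D. s x < s y} * ennreal (s x))"
  defines "L \<equiv> Sup (ennreal ` {l. 0 \<le> l \<and> (\<forall>x\<in>D. exp_moment X P a l x < \<top>)})"
  shows "1 / (4 * B) \<le> L" "L \<le> 1 / B"
proof -
  let ?N = "restrict_space m D"
  have Dm: "D \<inter> space m \<in> sets m" using m D by (simp add: sets_eq_imp_space_eq)
  have spN: "space ?N = D" using sets_eq_imp_space_eq[OF m] by (simp add: space_restrict_space)
  interpret N: finite_measure ?N
    by (rule finite_measureI) (use fin m D Dm in \<open>simp add: spN emeasure_restrict_space sets_eq_imp_space_eq\<close>)
  have sN: "s \<in> borel_measurable ?N"
    using s by (intro measurable_restrict_space1) (simp cong: measurable_cong_sets add: m)
  have BN: "B = (SUP x\<in>space ?N. emeasure ?N {y \<in> space ?N. s x < s y} * ennreal (s x))"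
    unfolding B spN by (intro SUP_cong refl arg_cong2[where f = "(*)"] emeasure_restrict_space[symmetric] Dm) auto
  have u_Suc: "hitting_moment a (Suc n) x = (\<integral>\<^sup>+y. ennreal (min (s x) (s y)) * hitting_moment a n y \<partial>?N)"
    if "x \<in> space ?N" for n x
    unfolding hitting_moment_Suc nn_integral_restrict_space[OF Dm]
    using that spN by (intro green) auto
  have L: "L = Sup (ennreal ` {l. 0 \<le> l \<and> (\<forall>x\<in>space ?N. (\<Sum>n. ennreal (l ^ n) * hitting_moment a n x) < \<top>)})"
    unfolding L_def spN by (intro arg_cong[where f = "\<lambda>A. Sup (ennreal ` A)"]) (auto simp: exp_moment_eq_suminf)
  show "1 / (4 * B) \<le> L" "L \<le> 1 / B"
    unfolding L
    using N.green_iterates_radius_bounds[where s = s and u = "hitting_moment a" and B = B, OF sN _ _ _ u_Suc BN]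
      s_pos s_surj hitting_moment_0 unfolding spN by blast+
qed

context
  fixes S :: "real \<Rightarrow> real" and m :: "real measure"
  assumes scale: "scale_function X P S" and speed: "speed_measure X P S m"
begin

lemma scale_less_iff [simp]: "S x < S y \<longleftrightarrow> x < y" and scale_le_iff [simp]: "S x \<le> S y \<longleftrightarrow> x \<le> y"
  using scale unfolding scale_function_def by (auto simp: strict_mono_less strict_mono_less_eq)

lemma continuous_on_scale: "continuous_on A S"
  using scale continuous_on_subset unfolding scale_function_def by blast

lemma measurable_scale [measurable]: "S \<in> borel_measurable borel"
  by (rule borel_measurable_continuous_onI) (rule continuous_on_scale)

lemma sets_speed: "sets m = sets borel"
  using speed unfolding speed_measure_def by simp

section \<open>The half-line to the right\<close>

lemma occupation_right_half_line:
  assumes x: "a < x"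
  defines "s \<equiv> \<lambda>y. S y - S a"
  shows "filterlim (\<lambda>n. s (x + real (Suc n))) at_top sequentially"
    and "f \<in> borel_measurable borel \<Longrightarrow>
      occupation x (hitting_time X a) f = (\<integral>\<^sup>+y\<in>{a<..}. ennreal (min (s x) (s y)) * f y \<partial>m)"
proof -
  \<comment> \<open>\<open>Suc n\<close> keeps the far end strictly beyond x from the start, as
    scale and speed require.\<close>
  let ?b = "\<lambda>n. x + real (Suc n)"
  have b: "filterlim (\<lambda>n. \<bar>?b n\<bar>) at_top sequentially"
  proof (rule filterlim_at_top_mono)
    show "filterlim ?b at_top sequentially"
      by (intro filterlim_tendsto_add_at_top[OF tendsto_const] filterlim_compose[OF filterlim_real_sequentially filterlim_Suc])
  qed (intro always_eventually allI abs_ge_self)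
  \<comment> \<open>The scale function gives the probability of reaching the far end first; the
    event wanted lies in the complement, and an upper bound suffices.\<close>
  have hit: "measure (P x) {w \<in> space (P x). hitting_time X a w < hitting_time X (?b n) w} \<le> 1 - s x / s (?b n)" for n
  proof -
    interpret prob_space "P x" by (rule prob_space_P)
    let ?E = "{w \<in> space (P x). hitting_time X (?b n) w < hitting_time X a w}"
    have "measure (P x) {w \<in> space (P x). hitting_time X a w < hitting_time X (?b n) w} \<le> measure (P x) (space (P x) - ?E)"
      by (intro finite_measure_mono) auto
    also have "\<dots> = 1 - measure (P x) ?E"
      by (rule prob_compl) measurable
    also have "measure (P x) ?E = s x / s (?b n)"
      using scale x unfolding scale_function_def s_def by simp
    finally show ?thesis .
  qed
  have green: "occupation x (\<lambda>w. min (hitting_time X a w) (hitting_time X (?b n) w)) f =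
      (\<integral>\<^sup>+y\<in>{a<..}. ennreal (min (s x) (s y) * max 0 (1 - max (s x) (s y) / s (?b n))) * f y \<partial>m)"
    if "f \<in> borel_measurable borel" for n f
  proof -
    have "occupation x (\<lambda>w. min (hitting_time X a w) (hitting_time X (?b n) w)) f =
        (\<integral>\<^sup>+y\<in>{a..?b n}. ennreal (green S a (?b n) x y) * f y \<partial>m)"
      using speed x that unfolding speed_measure_def by simp
    also have "\<dots> = (\<integral>\<^sup>+y\<in>{a<..}. ennreal (min (s x) (s y) * max 0 (1 - max (s x) (s y) / s (?b n))) * f y \<partial>m)"
    proof (rule nn_integral_cong)
      fix y
      have pos: "0 < s (?b n)" using x by (simp add: s_def)
      have "green S a (?b n) x y = min (s x) (s y) * max 0 (1 - max (s x) (s y) / s (?b n))" if y: "a < y" "y \<le> ?b n"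
      proof -
        have mx: "S (max x y) = max (S x) (S y)" "S (min x y) = min (S x) (S y)" by (auto simp: max_def min_def)
        have "max (s x) (s y) / s (?b n) \<le> 1" using pos y by (simp add: s_def)
        then have "max 0 (1 - max (s x) (s y) / s (?b n)) = (s (?b n) - max (s x) (s y)) / s (?b n)"
          using pos by (simp add: diff_divide_distrib)
        moreover have "max (s x) (s y) = max (S x) (S y) - S a" "min (s x) (s y) = min (S x) (S y) - S a"
          by (auto simp: s_def)
        ultimately show ?thesis by (simp add: green_def mx s_def mult_ac)
      qed
      moreover have "green S a (?b n) x y = 0" if "y = a" using that x by (simp add: green_def)
      moreover have "max 0 (1 - max (s x) (s y) / s (?b n)) = 0" if "?b n < y"
      proof -
        have "s (?b n) \<le> max (s x) (s y)" using that by (simp add: s_def le_max_iff_disj)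
        then show ?thesis using pos by (simp add: max_def field_simps)
      qed
      ultimately show "ennreal (green S a (?b n) x y) * f y * indicator {a..?b n} y =
          ennreal (min (s x) (s y) * max 0 (1 - max (s x) (s y) / s (?b n))) * f y * indicator {a<..} y"
        by (cases "y < a"; cases "y = a"; cases "y \<le> ?b n") auto
    qed
    finally show ?thesis .
  qed
  note lims = half_line_limits[where b = ?b and c = "\<lambda>n. s (?b n)" and s = s and D = "{a<..}" and x = x and a = a and m = m,
      OF b sets_speed _ _ _ _ hit green]
  show "filterlim (\<lambda>n. s (?b n)) at_top sequentially"
    by (rule lims(1)) (use x in \<open>auto simp: s_def\<close>)
  show "occupation x (hitting_time X a) f = (\<integral>\<^sup>+y\<in>{a<..}. ennreal (min (s x) (s y)) * f y \<partial>m)"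
    if "f \<in> borel_measurable borel"
    by (rule lims(2)) (use x that in \<open>auto simp: s_def\<close>)
qed

text \<open>The kernel vanishes at the target, so the target is moved back to a - 1: started at a,
  the kernel is then at least \<open>?q\<close> on all of \<open>{a<..}\<close>, and the finite mean
  hitting time bounds the mass.\<close>

lemma speed_finite_right: "emeasure m {a<..} < \<top>"
proof -
  let ?q = "S a - S (a - 1)"
  have q: "0 < ?q" by simp
  have "ennreal ?q * emeasure m {a<..} = (\<integral>\<^sup>+y. ennreal ?q * indicator {a<..} y \<partial>m)"
    by (subst nn_integral_cmult_indicator) (auto simp: sets_speed)
  also have "\<dots> \<le> (\<integral>\<^sup>+y\<in>{a - 1<..}. ennreal (min (S a - S (a - 1)) (S y - S (a - 1))) * 1 \<partial>m)"
    by (rule nn_integral_mono) (auto simp: indicator_def intro!: ennreal_leI)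
  also have "\<dots> = occupation a (hitting_time X (a - 1)) (\<lambda>_. 1)"
    by (rule occupation_right_half_line(2)[symmetric]) auto
  also have "\<dots> = occupation a (hitting_time X (a - 1)) (hitting_moment (a - 1) 0)"
    by (simp add: hitting_moment_0)
  also have "\<dots> = hitting_moment (a - 1) (Suc 0) a"
    by (simp only: hitting_moment_Suc)
  also have "\<dots> = (\<integral>\<^sup>+w. hitting_time X (a - 1) w \<partial>P a)"
    unfolding hitting_moment_def
    by (rule nn_integral_cong_AE) (use hitting_time_finite_AE[of "a - 1" a] in eventually_elim, auto)
  also have "\<dots> < \<top>" by (rule positively_recurrent)
  finally show ?thesis using q by (auto simp: ennreal_mult_less_top)
qed

lemma lambda_plus_bounds:
  "1 / (4 * B_plus S m a) \<le> lambda_plus X P a" "lambda_plus X P a \<le> 1 / B_plus S m a"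
proof -
  let ?s = "\<lambda>y. S y - S a"
  \<comment> \<open>The scale distance is 0 at \<open>a\<close>, continuous and unbounded, so it
    takes every positive value.\<close>
  have surj: "\<exists>x\<in>{a<..}. ?s x = r" if r: "0 < r" for r
  proof -
    have "\<forall>\<^sub>F n in sequentially. r < ?s (a + 1 + real (Suc n))"
      using occupation_right_half_line(1)[of a "a + 1"] by (simp add: filterlim_at_top_dense)
    then obtain n where n: "r < ?s (a + 1 + real (Suc n))" by (auto simp: eventually_sequentially)
    have "\<exists>x\<ge>a. x \<le> a + 1 + real (Suc n) \<and> S x = S a + r"
      by (rule IVT'[OF _ _ _ continuous_on_scale]) (use n r in auto)
    then obtain x where "a \<le> x" "S x = S a + r" by blast
    then show ?thesis using r by (intro bexI[of _ x]) (auto simp: order_le_less)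
  qed
  \<comment> \<open>The point x = a contributes 0, so closed and open half-lines give the same
    supremum.\<close>
  have B: "B_plus S m a = (SUP x\<in>{a<..}. emeasure m {y \<in> {a<..}. ?s x < ?s y} * ennreal (?s x))"
  proof -
    have eq: "emeasure m {y \<in> {a<..}. ?s x < ?s y} * ennreal (?s x) = emeasure m {x<..} * ennreal (?s x)" if "a < x" for x
      by (intro arg_cong2[where f = "(*)"] arg_cong[where f = "emeasure m"]) (use that in auto)
    show ?thesis unfolding B_plus_def
    proof (rule antisym)
      show "(SUP x\<in>{a..}. emeasure m {x<..} * ennreal (?s x)) \<le> (SUP x\<in>{a<..}. emeasure m {y \<in> {a<..}. ?s x < ?s y} * ennreal (?s x))"
      proof (rule SUP_least)
        fix x assume "x \<in> {a..}"
        show "emeasure m {x<..} * ennreal (?s x) \<le> (SUP x\<in>{a<..}. emeasure m {y \<in> {a<..}. ?s x < ?s y} * ennreal (?s x))"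
        proof (cases "x = a")
          case False
          then have "x \<in> {a<..}" using \<open>x \<in> {a..}\<close> by auto
          then show ?thesis by (rule SUP_upper2) (use eq[of x] \<open>x \<in> {a<..}\<close> in auto)
        qed simp
      qed
      show "(SUP x\<in>{a<..}. emeasure m {y \<in> {a<..}. ?s x < ?s y} * ennreal (?s x)) \<le> (SUP x\<in>{a..}. emeasure m {x<..} * ennreal (?s x))"
        by (rule SUP_mono) (use eq less_imp_le in fastforce)
    qed
  qed
  have L: "lambda_plus X P a = Sup (ennreal ` {l. 0 \<le> l \<and> (\<forall>x\<in>{a<..}. exp_moment X P a l x < \<top>)})"
    unfolding lambda_plus_def by (simp add: Ball_def)
  note bounds = exp_moment_radius_bounds[where s = ?s and D = "{a<..}" and a = a, OF sets_speed _ _ _ surj speed_finite_right _ B]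
  show "1 / (4 * B_plus S m a) \<le> lambda_plus X P a"
    unfolding L by (rule bounds(1)) (auto intro: occupation_right_half_line(2))
  show "lambda_plus X P a \<le> 1 / B_plus S m a"
    unfolding L by (rule bounds(2)) (auto intro: occupation_right_half_line(2))
qed

section \<open>The half-line to the left, by reflection\<close>

lemma occupation_left_half_line:
  assumes x: "x < a"
  defines "s \<equiv> \<lambda>y. S a - S y"
  shows "filterlim (\<lambda>n. s (x - real (Suc n))) at_top sequentially"
    and "f \<in> borel_measurable borel \<Longrightarrow>
      occupation x (hitting_time X a) f = (\<integral>\<^sup>+y\<in>{..<a}. ennreal (min (s x) (s y)) * f y \<partial>m)"
proof -
  let ?b = "\<lambda>n. x - real (Suc n)"
  have b: "filterlim (\<lambda>n. \<bar>?b n\<bar>) at_top sequentially"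
  proof (rule filterlim_at_top_mono)
    show "filterlim (\<lambda>n. - x + real (Suc n)) at_top sequentially"
      by (intro filterlim_tendsto_add_at_top[OF tendsto_const] filterlim_compose[OF filterlim_real_sequentially filterlim_Suc])
  qed (auto intro!: always_eventually)
  have hit: "measure (P x) {w \<in> space (P x). hitting_time X a w < hitting_time X (?b n) w} \<le> 1 - s x / s (?b n)" for n
  proof -
    have pos: "0 < s (?b n)" using x by (simp add: s_def)
    \<comment> \<open>Here \<open>a\<close> is the upper end of the interval, so the scale formula
      gives this probability directly.\<close>
    have "measure (P x) {w \<in> space (P x). hitting_time X a w < hitting_time X (?b n) w} = (S x - S (?b n)) / (S a - S (?b n))"
      using scale x unfolding scale_function_def by simp
    also have "\<dots> = (s (?b n) - s x) / s (?b n)" by (simp add: s_def)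
    also have "\<dots> = 1 - s x / s (?b n)" using pos by (simp add: diff_divide_distrib)
    finally show ?thesis by simp
  qed
  have green: "occupation x (\<lambda>w. min (hitting_time X a w) (hitting_time X (?b n) w)) f =
      (\<integral>\<^sup>+y\<in>{..<a}. ennreal (min (s x) (s y) * max 0 (1 - max (s x) (s y) / s (?b n))) * f y \<partial>m)"
    if "f \<in> borel_measurable borel" for n f
  proof -
    have swap: "min (hitting_time X a w) (hitting_time X (?b n) w) = min (hitting_time X (?b n) w) (hitting_time X a w)" for w
      by (rule min.commute)
    have "occupation x (\<lambda>w. min (hitting_time X a w) (hitting_time X (?b n) w)) f =
        (\<integral>\<^sup>+y\<in>{?b n..a}. ennreal (green S (?b n) a x y) * f y \<partial>m)"
      unfolding swap using speed x that unfolding speed_measure_def by simp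
    also have "\<dots> = (\<integral>\<^sup>+y\<in>{..<a}. ennreal (min (s x) (s y) * max 0 (1 - max (s x) (s y) / s (?b n))) * f y \<partial>m)"
    proof (rule nn_integral_cong)
      fix y
      have pos: "0 < s (?b n)" using x by (simp add: s_def)
      have "green S (?b n) a x y = min (s x) (s y) * max 0 (1 - max (s x) (s y) / s (?b n))" if y: "y < a" "?b n \<le> y"
      proof -
        have mx: "S (max x y) = max (S x) (S y)" "S (min x y) = min (S x) (S y)" by (auto simp: max_def min_def)
        have "max (s x) (s y) / s (?b n) \<le> 1" using pos y by (simp add: s_def)
        then have "max 0 (1 - max (s x) (s y) / s (?b n)) = (s (?b n) - max (s x) (s y)) / s (?b n)"
          using pos by (simp add: diff_divide_distrib)
        \<comment> \<open>The distance to \<open>a\<close> decreases in \<open>S\<close>, so maxima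
          and minima change places.\<close>
        moreover have "max (s x) (s y) = S a - min (S x) (S y)" "min (s x) (s y) = S a - max (S x) (S y)"
          by (auto simp: s_def max_def min_def)
        ultimately show ?thesis by (simp add: green_def mx s_def mult_ac)
      qed
      moreover have "green S (?b n) a x y = 0" if "y = a" using that x by (simp add: green_def)
      moreover have "max 0 (1 - max (s x) (s y) / s (?b n)) = 0" if "y < ?b n"
      proof -
        have "s (?b n) \<le> max (s x) (s y)" using that by (simp add: s_def le_max_iff_disj)
        then show ?thesis using pos by (simp add: max_def field_simps)
      qed
      ultimately show "ennreal (green S (?b n) a x y) * f y * indicator {?b n..a} y =
          ennreal (min (s x) (s y) * max 0 (1 - max (s x) (s y) / s (?b n))) * f y * indicator {..<a} y"
        by (cases "a < y"; cases "y = a"; cases "?b n \<le> y") auto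
    qed
    finally show ?thesis .
  qed
  note lims = half_line_limits[where b = ?b and c = "\<lambda>n. s (?b n)" and s = s and D = "{..<a}" and x = x and a = a and m = m,
      OF b sets_speed _ _ _ _ hit green]
  show "filterlim (\<lambda>n. s (?b n)) at_top sequentially"
    by (rule lims(1)) (use x in \<open>auto simp: s_def\<close>)
  show "occupation x (hitting_time X a) f = (\<integral>\<^sup>+y\<in>{..<a}. ennreal (min (s x) (s y)) * f y \<partial>m)"
    if "f \<in> borel_measurable borel"
    by (rule lims(2)) (use x that in \<open>auto simp: s_def\<close>)
qed

text \<open>Mirror image: the target a + 1 keeps the kernel away from 0 on the left of a.\<close>

lemma speed_finite_left: "emeasure m {..<a} < \<top>"
proof -
  let ?q = "S (a + 1) - S a"
  have q: "0 < ?q" by simp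
  have "ennreal ?q * emeasure m {..<a} = (\<integral>\<^sup>+y. ennreal ?q * indicator {..<a} y \<partial>m)"
    by (subst nn_integral_cmult_indicator) (auto simp: sets_speed)
  also have "\<dots> \<le> (\<integral>\<^sup>+y\<in>{..<a + 1}. ennreal (min (S (a + 1) - S a) (S (a + 1) - S y)) * 1 \<partial>m)"
    by (rule nn_integral_mono) (auto simp: indicator_def intro!: ennreal_leI)
  also have "\<dots> = occupation a (hitting_time X (a + 1)) (\<lambda>_. 1)"
    by (rule occupation_left_half_line(2)[symmetric]) auto
  also have "\<dots> = occupation a (hitting_time X (a + 1)) (hitting_moment (a + 1) 0)"
    by (simp add: hitting_moment_0)
  also have "\<dots> = hitting_moment (a + 1) (Suc 0) a"
    by (simp only: hitting_moment_Suc)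
  also have "\<dots> = (\<integral>\<^sup>+w. hitting_time X (a + 1) w \<partial>P a)"
    unfolding hitting_moment_def
    by (rule nn_integral_cong_AE) (use hitting_time_finite_AE[of "a + 1" a] in eventually_elim, auto)
  also have "\<dots> < \<top>" by (rule positively_recurrent)
  finally show ?thesis using q by (auto simp: ennreal_mult_less_top)
qed

lemma lambda_minus_bounds:
  "1 / (4 * B_minus S m a) \<le> lambda_minus X P a" "lambda_minus X P a \<le> 1 / B_minus S m a"
proof -
  let ?s = "\<lambda>y. S a - S y"
  have surj: "\<exists>x\<in>{..<a}. ?s x = r" if r: "0 < r" for r
  proof -
    have "\<forall>\<^sub>F n in sequentially. r < ?s (a - 1 - real (Suc n))"
      using occupation_left_half_line(1)[of "a - 1" a] by (simp add: filterlim_at_top_dense)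
    then obtain n where n: "r < ?s (a - 1 - real (Suc n))" by (auto simp: eventually_sequentially)
    have "\<exists>x\<ge>a - 1 - real (Suc n). x \<le> a \<and> S x = S a - r"
      by (rule IVT'[OF _ _ _ continuous_on_scale]) (use n r in auto)
    then obtain x where "x \<le> a" "S x = S a - r" by blast
    then show ?thesis using r by (intro bexI[of _ x]) (auto simp: order_le_less)
  qed
  have B: "B_minus S m a = (SUP x\<in>{..<a}. emeasure m {y \<in> {..<a}. ?s x < ?s y} * ennreal (?s x))"
  proof -
    have eq: "emeasure m {y \<in> {..<a}. ?s x < ?s y} * ennreal (?s x) = emeasure m {..<x} * ennreal (?s x)" if "x < a" for x
      by (intro arg_cong2[where f = "(*)"] arg_cong[where f = "emeasure m"]) (use that in auto)
    show ?thesis unfolding B_minus_def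
    proof (rule antisym)
      show "(SUP x\<in>{..a}. emeasure m {..<x} * ennreal (?s x)) \<le> (SUP x\<in>{..<a}. emeasure m {y \<in> {..<a}. ?s x < ?s y} * ennreal (?s x))"
      proof (rule SUP_least)
        fix x assume "x \<in> {..a}"
        show "emeasure m {..<x} * ennreal (?s x) \<le> (SUP x\<in>{..<a}. emeasure m {y \<in> {..<a}. ?s x < ?s y} * ennreal (?s x))"
        proof (cases "x = a")
          case False
          then have "x \<in> {..<a}" using \<open>x \<in> {..a}\<close> by auto
          then show ?thesis by (rule SUP_upper2) (use eq[of x] \<open>x \<in> {..<a}\<close> in auto)
        qed simp
      qed
      show "(SUP x\<in>{..<a}. emeasure m {y \<in> {..<a}. ?s x < ?s y} * ennreal (?s x)) \<le> (SUP x\<in>{..a}. emeasure m {..<x} * ennreal (?s x))"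
        by (rule SUP_mono) (use eq less_imp_le in fastforce)
    qed
  qed
  have L: "lambda_minus X P a = Sup (ennreal ` {l. 0 \<le> l \<and> (\<forall>x\<in>{..<a}. exp_moment X P a l x < \<top>)})"
    unfolding lambda_minus_def by (simp add: Ball_def)
  note bounds = exp_moment_radius_bounds[where s = ?s and D = "{..<a}" and a = a, OF sets_speed _ _ _ surj speed_finite_left _ B]
  show "1 / (4 * B_minus S m a) \<le> lambda_minus X P a"
    unfolding L by (rule bounds(1)) (auto intro: occupation_left_half_line(2))
  show "lambda_minus X P a \<le> 1 / B_minus S m a"
    unfolding L by (rule bounds(2)) (auto intro: occupation_left_half_line(2))
qed

end

end

theorem theorem1p1:
  fixes M :: "'w measure" and m :: "real measure" and X :: "real \<Rightarrow> 'w \<Rightarrow> real" and P :: "real \<Rightarrow> 'w measure"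
    and S :: "real \<Rightarrow> real" and a :: real
  assumes "positively_recurrent_diffusion M X P"
    and "scale_function X P S"
    and "speed_measure X P S m"
  shows "1 / (4 * B_plus S m a) \<le> lambda_plus X P a \<and> lambda_plus X P a \<le> 1 / B_plus S m a \<and>
         1 / (4 * B_minus S m a) \<le> lambda_minus X P a \<and> lambda_minus X P a \<le> 1 / B_minus S m a"
proof -
  interpret positively_recurrent_diffusion M X P by (rule assms(1))
  show ?thesis
    using lambda_plus_bounds[OF assms(2,3)] lambda_minus_bounds[OF assms(2,3)] by blast
qed

end
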